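(* Let $S$ be a connected graph with $S\neq P_3$ and let $G$ be a $2$-connected $K_{1,3}$-$f_1$-heavy graph which is not a cycle. If $S\in\{P_4,Z_1,Z_2\}$ and $G$ is $S$-$f_1$-heavy, then $G$ is pancyclic.
   Context: All graphs are finite and simple. Let $G$ be a graph on $n$ vertices, and $d(x)$ the degree of $x$ in $G$. For a subgraph $H$ and $x,y\in V(H)$, $d_H(x,y)$ is the length of a shortest $(x,y)$-path in $H$. An induced subgraph $H$ of $G$ is called $f_1$-heavy if for every pair of vertices $u,v\in V(H)$ with $d_H(u,v)=2$ we have $\max\{d(u),d(v)\}\geq (n+1)/2$ (degrees taken in $G$). For a graph $R$, $G$ is $R$-$f_1$-heavy if every induced subgraph of $G$ isomorphic to $R$ is $f_1$-heavy. $K_{1,3}$ is the claw, $P_k$ is the path on $k$ vertices, and $Z_i$ is the graph obtained from the path $a_1a_2\cdots a_{i+3}$ by adding the edge $a_1a_3$. A graph on $n$ vertices is pancyclic if it contains cycles of every length from $3$ to $n$. *)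

theory Defs
  imports Main
begin

definition simple_graph :: "'a set \<Rightarrow> ('a \<Rightarrow> 'a \<Rightarrow> bool) \<Rightarrow> bool" where
  "simple_graph V E \<longleftrightarrow> finite V \<and> (\<forall>x y. E x y \<longrightarrow> x \<in> V \<and> y \<in> V)
     \<and> (\<forall>x y. E x y \<longrightarrow> E y x) \<and> (\<forall>x. \<not> E x x)"

definition degree :: "'a set \<Rightarrow> ('a \<Rightarrow> 'a \<Rightarrow> bool) \<Rightarrow> 'a \<Rightarrow> nat" where
  "degree V E x = card {y \<in> V. E x y}"

definition walk_in :: "'a set \<Rightarrow> ('a \<Rightarrow> 'a \<Rightarrow> bool) \<Rightarrow> 'a list \<Rightarrow> bool" where
  "walk_in X E xs \<longleftrightarrow> xs \<noteq> [] \<and> set xs \<subseteq> X \<and>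
     (\<forall>i. Suc i < length xs \<longrightarrow> E (xs ! i) (xs ! Suc i))"

definition has_walk :: "'a set \<Rightarrow> ('a \<Rightarrow> 'a \<Rightarrow> bool) \<Rightarrow> 'a \<Rightarrow> 'a \<Rightarrow> nat \<Rightarrow> bool" where
  "has_walk X E u v k \<longleftrightarrow> (\<exists>xs. walk_in X E xs \<and> hd xs = u \<and> last xs = v \<and> length xs = Suc k)"

definition dist_eq :: "'a set \<Rightarrow> ('a \<Rightarrow> 'a \<Rightarrow> bool) \<Rightarrow> 'a \<Rightarrow> 'a \<Rightarrow> nat \<Rightarrow> bool" where
  "dist_eq X E u v d \<longleftrightarrow> has_walk X E u v d \<and> (\<forall>k<d. \<not> has_walk X E u v k)"

definition connected_graph :: "'a set \<Rightarrow> ('a \<Rightarrow> 'a \<Rightarrow> bool) \<Rightarrow> bool" where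
  "connected_graph V E \<longleftrightarrow> V \<noteq> {} \<and> (\<forall>u\<in>V. \<forall>v\<in>V. \<exists>k. has_walk V E u v k)"

definition two_connected :: "'a set \<Rightarrow> ('a \<Rightarrow> 'a \<Rightarrow> bool) \<Rightarrow> bool" where
  "two_connected V E \<longleftrightarrow> card V \<ge> 3 \<and> connected_graph V E \<and>
     (\<forall>v\<in>V. connected_graph (V - {v}) E)"

definition is_cycle :: "'a set \<Rightarrow> ('a \<Rightarrow> 'a \<Rightarrow> bool) \<Rightarrow> 'a list \<Rightarrow> bool" where
  "is_cycle V E xs \<longleftrightarrow> length xs \<ge> 3 \<and> distinct xs \<and> set xs \<subseteq> V \<and>
     (\<forall>i < length xs. E (xs ! i) (xs ! ((Suc i) mod length xs)))"

definition pancyclic :: "'a set \<Rightarrow> ('a \<Rightarrow> 'a \<Rightarrow> bool) \<Rightarrow> bool" where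
  "pancyclic V E \<longleftrightarrow> (\<forall>k. 3 \<le> k \<and> k \<le> card V \<longrightarrow> (\<exists>xs. is_cycle V E xs \<and> length xs = k))"

definition is_cycle_graph :: "'a set \<Rightarrow> ('a \<Rightarrow> 'a \<Rightarrow> bool) \<Rightarrow> bool" where
  "is_cycle_graph V E \<longleftrightarrow> (\<exists>xs. is_cycle V E xs \<and> set xs = V \<and>
     (\<forall>x y. E x y \<longleftrightarrow> (\<exists>i < length xs.
        (x = xs ! i \<and> y = xs ! ((Suc i) mod length xs)) \<or>
        (y = xs ! i \<and> x = xs ! ((Suc i) mod length xs)))))"

definition induced_copy :: "'a set \<Rightarrow> ('a \<Rightarrow> 'a \<Rightarrow> bool) \<Rightarrow> 'b set \<Rightarrow> ('b \<Rightarrow> 'b \<Rightarrow> bool) \<Rightarrow> 'a set \<Rightarrow> bool" where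
  "induced_copy V E VR ER X \<longleftrightarrow> X \<subseteq> V \<and>
     (\<exists>f. bij_betw f VR X \<and> (\<forall>a\<in>VR. \<forall>b\<in>VR. ER a b \<longleftrightarrow> E (f a) (f b)))"

definition f1_heavy :: "'a set \<Rightarrow> ('a \<Rightarrow> 'a \<Rightarrow> bool) \<Rightarrow> 'a set \<Rightarrow> bool" where
  "f1_heavy V E X \<longleftrightarrow> (\<forall>u\<in>X. \<forall>v\<in>X. dist_eq X E u v 2 \<longrightarrow>
     2 * max (degree V E u) (degree V E v) \<ge> card V + 1)"

definition R_f1_heavy :: "'a set \<Rightarrow> ('a \<Rightarrow> 'a \<Rightarrow> bool) \<Rightarrow> 'b set \<Rightarrow> ('b \<Rightarrow> 'b \<Rightarrow> bool) \<Rightarrow> bool" where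
  "R_f1_heavy V E VR ER \<longleftrightarrow> (\<forall>X. induced_copy V E VR ER X \<longrightarrow> f1_heavy V E X)"

definition claw :: "nat set \<times> (nat \<Rightarrow> nat \<Rightarrow> bool)" where
  "claw = ({0,1,2,3}, \<lambda>a b. (a = 0 \<and> b \<in> {1,2,3}) \<or> (b = 0 \<and> a \<in> {1,2,3}))"

definition path_graph :: "nat \<Rightarrow> nat set \<times> (nat \<Rightarrow> nat \<Rightarrow> bool)" where
  "path_graph k = ({0..<k}, \<lambda>a b. a < k \<and> b < k \<and> (b = Suc a \<or> a = Suc b))"

definition Z_graph :: "nat \<Rightarrow> nat set \<times> (nat \<Rightarrow> nat \<Rightarrow> bool)" where
  "Z_graph i = ({0..<i+3}, \<lambda>a b. (a < i+3 \<and> b < i+3 \<and> (b = Suc a \<or> a = Suc b))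
                              \<or> (a = 0 \<and> b = 2) \<or> (a = 2 \<and> b = 0))"

end

theory Submission
  imports Defs
begin

text \<open>
  Call a vertex heavy if its degree is at least \<open>(n + 1) / 2\<close>. All three choices of \<open>S\<close> imply one
  condition: in an induced \<open>Z\<^sub>2\<close> the middle vertex of the tail or both of the vertices of degree two in the
  triangle are heavy. Together with the claw condition and an Ore-type closing of paths between
  heavy vertices it makes the graph Hamiltonian, by extending a cycle that contains the most
  heavy vertices, and, among these, the most vertices. If no vertex is heavy, then the same local analysis
  extends every cycle by exactly one vertex.

  If \<open>h\<close> is heavy and the graph without \<open>h\<close> has a Hamiltonian cycle, then for every \<open>s\<close> two neighbours of \<open>h\<close>
  are at distance \<open>s\<close> on this cycle, so the graph is pancyclic. It is also pancyclic if two heavy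
  vertices are consecutive on a Hamiltonian cycle. In a counterexample, therefore,
  deleting \<open>h\<close> leaves a graph that is not 2-connected, and \<open>h\<close> lies in a cut \<open>{h, w}\<close> that splits a Hamiltonian cycle
  into two arcs whose ends next to \<open>h\<close> are light. These light ends force the neighbours of \<open>h\<close> on each
  arc to be almost complete to each other, and shortcuts through them yield all cycle lengths.
\<close>

section \<open>Paths and cycles\<close>

text \<open>The threshold (n + 1)/2 exceeds what an Ore closing needs by one half, and this surplus
  is spent twice. Two heavy vertices have degree sum at least n + 1, which is what the pigeonhole
  for all cycle lengths asks for. If one vertex is deleted, their degree sum is still at least n -
  1, so the Hamiltonicity theorem applies to the smaller graph as well. For this reuse
  \<open>W\<close> stays abstract: the claw and Z_2 conditions do not mention degrees and pass to
  induced subgraphs with the old \<open>W\<close>, although its members need not be heavy there. In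
  the same spirit \<open>E\<close> is not confined to \<open>V\<close>, so that a deletion changes
  only \<open>V\<close>. The obstacle is that a deletion may destroy 2-connectedness. The resulting
  cut then becomes the main tool: since a Hamiltonian cycle runs through it, two vertices inside
  different arcs have degree sum at most n, so one of the arcs contains no heavy vertex at
  all.\<close>

locale sgraph =
  fixes V :: "'a set" and E :: "'a \<Rightarrow> 'a \<Rightarrow> bool"
  assumes fin: "finite V"
    and sym: "E x y \<Longrightarrow> E y x"
    and irr: "\<not> E x x"
begin

definition pth :: "'a list \<Rightarrow> bool" where
  "pth xs \<longleftrightarrow> distinct xs \<and> set xs \<subseteq> V \<and> successively E xs"

definition cyc :: "'a list \<Rightarrow> bool" where
  "cyc xs \<longleftrightarrow> length xs \<ge> 3 \<and> pth xs \<and> E (last xs) (hd xs)"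

lemma sym_iff: "E x y \<longleftrightarrow> E y x"
  using sym by blast

lemma successively_rev_E: "successively E (rev xs) \<longleftrightarrow> successively E xs"
proof -
  have "(\<lambda>x y. E y x) = E" using sym by blast
  then show ?thesis by (metis successively_rev)
qed

lemmas pcs = successively_append_iff successively_Cons hd_append last_append hd_rev last_rev
  successively_rev_E

lemma pth_rev: "pth (rev xs) \<longleftrightarrow> pth xs"
  by (simp add: pth_def successively_rev_E del: successively_rev)

lemma cyc_rotate: "cyc (xs @ ys) \<Longrightarrow> cyc (ys @ xs)"
  by (cases "xs = []"; cases "ys = []") (auto simp: cyc_def pth_def pcs)

lemma cyc_rev: "cyc xs \<Longrightarrow> cyc (rev xs)"
  by (auto simp: cyc_def pth_rev pcs intro: sym simp del: successively_rev)

lemma cyc_imp_is_cycle: "cyc xs \<Longrightarrow> is_cycle V E xs"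
  unfolding is_cycle_def
proof (intro conjI allI impI)
  fix i assume c: "cyc xs" and i: "i < length xs"
  show "E (xs ! i) (xs ! (Suc i mod length xs))"
  proof (cases "Suc i < length xs")
    case True
    then show ?thesis using c by (simp add: cyc_def pth_def successively_nth)
  next
    case False
    then have "Suc i = length xs" using i by simp
    moreover have "E (last xs) (hd xs)" "xs \<noteq> []" using c by (auto simp: cyc_def)
    ultimately show ?thesis by (metis diff_Suc_1 hd_conv_nth last_conv_nth mod_self)
  qed
qed (auto simp: cyc_def pth_def)

definition has_len :: "nat \<Rightarrow> bool" where
  "has_len k \<longleftrightarrow> (\<exists>xs. cyc xs \<and> length xs = k)"

lemma pancyclicI:
  assumes "\<And>k. 3 \<le> k \<Longrightarrow> k \<le> card V \<Longrightarrow> has_len k"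
  shows "pancyclic V E"
  using assms cyc_imp_is_cycle unfolding pancyclic_def has_len_def by metis

lemma cyc_at:
  assumes "cyc C" "a \<in> set C"
  obtains C' where "cyc (a # C')" "set (a # C') = set C"
proof -
  obtain xs ys where "C = xs @ a # ys" using assms(2) by (meson split_list)
  then have "cyc (a # ys @ xs)" using cyc_rotate[of xs "a # ys"] assms(1) by simp
  then show thesis using that[of "ys @ xs"] \<open>C = xs @ a # ys\<close> by auto
qed

lemma cyc_at2:
  assumes "cyc C" "a \<in> set C" "b \<in> set C" "a \<noteq> b"
  obtains A B where "cyc (a # A @ b # B)" "set (a # A @ b # B) = set C"
proof -
  obtain C' where C': "cyc (a # C')" "set (a # C') = set C" using cyc_at assms by metis
  then have "b \<in> set C'" using assms by auto
  then obtain A B where "C' = A @ b # B" by (meson split_list)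
  then show thesis using that C' by blast
qed

lemma connected_union:
  assumes "pth p" "p \<noteq> []"
  shows "connected_graph (set p) E"
proof -
  have *: "\<exists>k. has_walk (set p) E u v k"
    if uv: "u \<in> set p" "v \<in> set p" for u v
  proof -
    have w: "\<exists>xs. walk_in (set p) E xs \<and> hd xs = u \<and> last xs = v" if p: "pth p" "u \<in> set p" "v \<in> set p"
      and ord: "p = p1 @ u # p2" "v \<in> set (u # p2)" for p p1 p2 u v
    proof -
      obtain q r where q: "u # p2 = q @ v # r" using ord(2) by (meson split_list)
      have s: "successively E (q @ [v])"
        using p(1) ord(1) q by (auto simp: pth_def pcs)
      have "walk_in (set p) E (q @ [v])"
        using s ord(1) q unfolding walk_in_def successively_conv_nth by (auto simp del: successively_rev)
      moreover have "hd (q @ [v]) = u" using q by (cases q) auto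
      ultimately show ?thesis by force
    qed
    have "\<exists>xs. walk_in (set p) E xs \<and> hd xs = u \<and> last xs = v"
    proof -
      obtain p1 p2 where p1: "p = p1 @ u # p2" using uv(1) by (meson split_list)
      show ?thesis
      proof (cases "v \<in> set (u # p2)")
        case True
        then show ?thesis using w[OF assms(1) uv p1] by blast
      next
        case False
        then have "v \<in> set p1" using uv p1 by auto
        then obtain q r where "p1 = q @ v # r" by (meson split_list)
        then have "rev p = rev p2 @ u # rev r @ v # rev q" using p1 by simp
        then have "\<exists>xs. walk_in (set (rev p)) E xs \<and> hd xs = u \<and> last xs = v"
          using assms(1) uv pth_rev[of p] by (intro w) auto
        then show ?thesis by simp
      qed
    qed
    then show ?thesis unfolding has_walk_def
      by (metis Suc_pred length_greater_0_conv walk_in_def)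
  qed
  show ?thesis using * assms(2) unfolding connected_graph_def by auto
qed

text \<open>Induction along a walk from \<open>x\<close>: it is stopped at the first vertex of
  \<open>S\<close>, and a vertex that recurs in the path already built cuts off the loop in front of
  it.\<close>

lemma connected_path_hit:
  assumes "connected_graph X E" "X \<subseteq> V" "x \<in> X" "S \<inter> X \<noteq> {}"
  obtains p where "p \<noteq> []" "hd p = x" "pth p" "set p \<subseteq> X" "last p \<in> S" "set (butlast p) \<inter> S = {}"
proof -
  obtain s where s: "s \<in> S" "s \<in> X" using assms(4) by auto
  obtain k where "has_walk X E x s k" using assms s unfolding connected_graph_def by blast
  then obtain ws where ws: "walk_in X E ws" "hd ws = x" "last ws = s" unfolding has_walk_def by blast
  have "successively E ws" "set ws \<subseteq> X" "ws \<noteq> []"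
    using ws unfolding walk_in_def successively_conv_nth by auto
  moreover have "\<exists>p. p \<noteq> [] \<and> hd p = hd ws \<and> pth p \<and> set p \<subseteq> X \<and> last p \<in> S \<and> set (butlast p) \<inter> S = {}"
    if "successively E ws" "set ws \<subseteq> X" "ws \<noteq> []" "last ws \<in> S" for ws
    using that
  proof (induction ws)
    case Nil then show ?case by simp
  next
    case (Cons a ws)
    show ?case
    proof (cases "a \<in> S \<or> ws = []")
      case True
      then show ?thesis using Cons.prems assms(2) by (intro exI[of _ "[a]"]) (auto simp: pth_def)
    next
      case False
      then obtain p where p: "p \<noteq> []" "hd p = hd ws" "pth p" "set p \<subseteq> X" "last p \<in> S" "set (butlast p) \<inter> S = {}"
        using Cons by (auto simp: successively_Cons)
      show ?thesis
      proof (cases "a \<in> set p")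
        case True
        then obtain p1 p2 where "p = p1 @ a # p2" by (meson split_list)
        then show ?thesis using p by (intro exI[of _ "a # p2"]) (auto simp: pth_def pcs butlast_append)
      next
        case nin: False
        then show ?thesis using p False Cons.prems assms(2)
          by (intro exI[of _ "a # p"]) (auto simp: pth_def pcs)
      qed
    qed
  qed
  ultimately show thesis using that ws s by metis
qed

end

section \<open>Ears and a lemma of Ore type\<close>

context sgraph
begin

lemma two_connected_path_hit:
  assumes "two_connected V E" "v \<in> V" "x \<in> V" "x \<noteq> v" "S \<subseteq> V" "s \<in> S" "s \<noteq> v"
  obtains p where "p \<noteq> []" "hd p = x" "pth p" "v \<notin> set p" "last p \<in> S" "set (butlast p) \<inter> S = {}"
proof -
  have "connected_graph (V - {v}) E" using assms unfolding two_connected_def by blast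
  then show thesis using connected_path_hit[of "V - {v}" x S thesis] assms that by fast
qed

text \<open>\<open>es\<close> lists the inner vertices only; \<open>a\<close> and \<open>b\<close>
  are the attachment points in \<open>S\<close>. One inner vertex suffices, but a chord of
  \<open>S\<close> is not an ear.\<close>

definition ear :: "'a set \<Rightarrow> 'a list \<Rightarrow> 'a \<Rightarrow> 'a \<Rightarrow> bool" where
  "ear S es a b \<longleftrightarrow> es \<noteq> [] \<and> pth es \<and> set es \<inter> S = {} \<and> a \<in> S \<and> b \<in> S \<and> a \<noteq> b
     \<and> E a (hd es) \<and> E (last es) b"

lemma ear_rev: "ear S es a b \<Longrightarrow> ear S (rev es) b a"
  by (auto simp: ear_def pth_rev pcs intro: sym simp del: successively_rev)

text \<open>An ear can replace either arc of the cycle. It can also be used together with both arcs: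
  the crossing path starts at \<open>hd A\<close>, traverses the ear backwards from \<open>b\<close>
  to \<open>a\<close> and ends at \<open>hd B\<close>, missing no vertex. Its two ends are where
  heavy vertices are wanted later.\<close>

lemma cyc_ear:
  assumes c: "cyc (a # A @ b # B)" and e: "ear (set (a # A @ b # B)) es a b"
  shows "cyc (a # es @ b # B)" "cyc (a # A @ b # rev es)" "pth (A @ b # rev es @ a # rev B)"
    "distinct (es @ a # A @ b # B)"
proof -
  have e': "es \<noteq> []" "pth es" "set es \<inter> set (a # A @ b # B) = {}" "E a (hd es)" "E (last es) b"
    "E (hd es) a" "E b (last es)" using e sym by (auto simp: ear_def)
  show d: "distinct (es @ a # A @ b # B)" using c e' by (simp add: cyc_def pth_def)
  have V: "set (es @ a # A @ b # B) \<subseteq> V" using c e' by (simp add: cyc_def pth_def)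
  have s: "successively E (a # A @ b # B)" "E (last (b # B)) a" using c by (auto simp: cyc_def pth_def)
  have s': "successively E (b # B)" "successively E (a # A)" "E (last (a # A)) b" "successively E A" "successively E B"
    "B \<noteq> [] \<Longrightarrow> E (last B) a" "A \<noteq> [] \<Longrightarrow> E (last A) b"
    using s(1) s(2) by (auto simp: pcs split: if_splits)
  have l: "length es \<ge> 1" using e'(1) by (simp add: Suc_le_eq)
  have "distinct (a # es @ b # B)" "distinct (a # A @ b # rev es)" "distinct (A @ b # rev es @ a # rev B)"
    using d by auto
  moreover have "successively E (a # es @ b # B)" using s' s(2) e' by (simp add: pcs pth_def)
  moreover have "successively E ((a # A) @ b # rev es)"
    using s' e' by (simp only: successively_append_iff successively_rev_E successively_Cons hd_rev pth_def) simp
  moreover have "successively E (A @ b # rev es @ a # rev B)"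
    using s' e' sym by (simp only: successively_append_iff successively_rev_E successively_Cons hd_rev last_rev pth_def)
      (auto simp: hd_append hd_rev last_rev)
  moreover have "E (last (a # es @ b # B)) a" "E (last (a # A @ b # rev es)) a"
    using s(2) e' by (simp_all add: last_rev)
  ultimately show "cyc (a # es @ b # B)" "cyc (a # A @ b # rev es)" "pth (A @ b # rev es @ a # rev B)"
    using V l by (auto simp: cyc_def pth_def)
qed

lemma successively_ear:
  assumes "U \<noteq> []" "R \<noteq> []" "es \<noteq> []" "successively E U" "successively E R" "successively E es"
    and "E (last U) b" "E b (last es)" "E (hd es) a" "E (last R) a"
  shows "successively E (U @ b # rev es @ a # rev R)"
  using assms sym by (simp add: pcs del: successively_rev)

text \<open>Two internally disjoint paths from \<^term>\<open>x\<close> to a set, glued at \<^term>\<open>x\<close>, by induction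
  along a path from \<^term>\<open>x\<close> to the set.\<close>

lemma ear_through:
  assumes tc: "two_connected V E" and S: "S \<subseteq> V" "card S \<ge> 2" and x: "x \<in> V - S"
  shows "\<exists>es a b. ear S es a b \<and> x \<in> set es"
proof -
  have other: "\<exists>s\<in>S. s \<noteq> v" for v
  proof (rule ccontr)
    assume "\<not> ?thesis"
    then have "S \<subseteq> {v}" by auto
    then show False using S(2) card_mono[of "{v}" S] by simp
  qed
  obtain p where p: "p \<noteq> []" "hd p = x" "pth p" "set p \<subseteq> V" "last p \<in> S" "set (butlast p) \<inter> S = {}"
  proof -
    have "connected_graph V E" using tc unfolding two_connected_def by blast
    moreover have "S \<inter> V \<noteq> {}" using S other by blast
    ultimately show thesis using connected_path_hit[of V x S thesis] x that by blast
  qed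
  from p x show ?thesis
  proof (induction p arbitrary: x)
    case Nil then show ?case by simp
  next
    case (Cons y p)
    then have [simp]: "y = x" by simp
    have pn: "p \<noteq> []" using Cons.prems by auto
    have pp: "pth p" "E x (hd p)" "x \<notin> set p" using Cons.prems pn by (auto simp: pth_def successively_Cons)
    show ?case
    proof (cases "hd p \<in> S")
      case True
      obtain s where s: "s \<in> S" "s \<noteq> hd p" using other by blast
      obtain r where r: "r \<noteq> []" "hd r = x" "pth r" "hd p \<notin> set r" "last r \<in> S" "set (butlast r) \<inter> S = {}"
        using two_connected_path_hit[OF tc, of "hd p" x S s thesis] True S s Cons.prems(7) by auto
      have bn: "butlast r \<noteq> []" using r Cons.prems(7) by (cases r) auto
      have "last r \<in> set r" using r by simp
      then have ne: "hd p \<noteq> last r" using r by auto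
      have "pth (butlast r @ [last r])" using r by simp
      then have rr: "pth (butlast r)" "E (last (butlast r)) (last r)"
        using bn by (auto simp: pth_def pcs)
      have h: "hd (butlast r) = x" using bn r by (metis append_butlast_last_id hd_append2)
      have "ear S (butlast r) (hd p) (last r)"
        using rr bn r ne True pp(2) h unfolding ear_def by (auto intro: sym)
      then show ?thesis using h bn hd_in_set by blast
    next
      case False
      let ?x' = "hd p"
      have "?x' \<in> V - S" using False Cons.prems(4) pn by auto
      moreover have "last p \<in> S" "set (butlast p) \<inter> S = {}" "set p \<subseteq> V" using Cons.prems pn by auto
      ultimately obtain es a b where es: "ear S es a b" "?x' \<in> set es"
        using Cons.IH[of "hd p"] pn pp by blast
      show ?thesis
      proof (cases "x \<in> set es")
        case True then show ?thesis using es by blast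
      next
        case nin: False
        obtain L M where LM: "es = L @ ?x' # M" using es(2) by (meson split_list)
        have esV: "set es \<subseteq> V" using es(1) by (auto simp: ear_def pth_def)
        \<comment> \<open>Avoiding \<open>hd p\<close> is what makes this route from
          \<open>x\<close> different from the edge to \<open>hd p\<close>; it is cut where it first
          meets \<open>S\<close> or the old ear.\<close>
        obtain r where r: "r \<noteq> []" "hd r = x" "pth r" "?x' \<notin> set r" "last r \<in> S \<union> set es"
          "set (butlast r) \<inter> (S \<union> set es) = {}"
          using two_connected_path_hit[OF tc, of ?x' x "S \<union> set es" a thesis] \<open>?x' \<in> V - S\<close> Cons.prems(7) S esV es(1) False irr pp(2)
          unfolding ear_def by auto
        define R z where "R = butlast r" and "z = last r"
        have bn: "R \<noteq> []" using r Cons.prems(7) nin unfolding R_def by (cases r) auto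
        have rz: "r = R @ [z]" using r unfolding R_def z_def by simp
        have R: "pth R" "E (last R) z" "hd R = x" "?x' \<notin> set R" "?x' \<noteq> z" "z \<in> S \<union> set es"
          "set R \<inter> (S \<union> set es) = {}" "z \<notin> set R" "z \<in> V"
          using r bn unfolding rz by (auto simp: pth_def pcs)
        have xR: "x \<in> set R" using R bn by (metis hd_in_set)
        note d = ear_def pth_def pcs
        note facts = es(1) LM R bn pp(2) sym[OF pp(2)] sym[OF R(2)] xR
        \<comment> \<open>The landing point \<open>z\<close> decides which half of the old ear is
          kept. Ending at \<open>b\<close> is separate because the two attachment points must
          differ.\<close>
        consider (1) "z \<in> S" "z \<noteq> b" | (2) "z \<in> S" "z = b" | (3) "z \<in> set L" | (4) "z \<in> set M"
          using R(5,6) LM by auto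
        then show ?thesis
        proof cases
          case 1
          have "ear S (rev R @ ?x' # M) z b"
            using 1 facts by (auto simp: d simp del: successively_rev)
          then show ?thesis using xR by (intro exI[of _ "rev R @ ?x' # M"]) auto
        next
          case 2
          have "ear S ((L @ [?x']) @ R) a b"
            using 2 facts by (cases "L = []") (auto simp: d simp del: successively_rev)
          then show ?thesis using xR by (intro exI[of _ "(L @ [?x']) @ R"]) auto
        next
          case 3
          then obtain L1 L2 where "L = L1 @ z # L2" by (meson split_list)
          then have "ear S (L1 @ z # rev R @ ?x' # M) a b"
            using facts by (cases "L1 = []") (auto simp: d simp del: successively_rev)
          then show ?thesis using xR by (intro exI[of _ "L1 @ z # rev R @ ?x' # M"]) auto
        next
          case 4
          then obtain M1 M2 where "M = M1 @ z # M2" by (meson split_list)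
          then have "ear S (L @ ?x' # R @ z # M2) a b"
            using facts by (cases "L = []") (auto simp: d simp del: successively_rev)
          then show ?thesis using xR by (intro exI[of _ "L @ ?x' # R @ z # M2"]) auto
        qed
      qed
    qed
  qed
qed

text \<open>A common neighbour of the ends outside the path closes it. Otherwise the outer
  neighbourhoods are disjoint, so the degrees inside the path still sum to at least its length and
  two crossing chords exist. The first case adds a vertex, hence only an inclusion is
  claimed.\<close>

lemma ore_cycle:
  assumes q: "pth q" "length q \<ge> 3"
    and d: "degree V E (hd q) + degree V E (last q) \<ge> card V"
  shows "\<exists>c. cyc c \<and> set q \<subseteq> set c"
proof (cases "E (last q) (hd q)")
  case True
  then show ?thesis using q unfolding cyc_def by blast
next
  case nE: False
  let ?u = "hd q" and ?v = "last q" and ?n = "length q"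
  have qn: "q \<noteq> []" using q by auto
  show ?thesis
  proof (cases "\<exists>z\<in>V - set q. E ?u z \<and> E ?v z")
    case True
    then obtain z where "z \<in> V - set q" "E ?u z" "E ?v z" by blast
    then have "cyc (q @ [z])" using q qn by (auto simp: cyc_def pth_def pcs intro: sym)
    then show ?thesis by (intro exI[of _ "q @ [z]"]) auto
  next
    case False
    define NU NV where "NU = {y\<in>V. E ?u y}" and "NV = {y\<in>V. E ?v y}"
    have qV: "set q \<subseteq> V" and dq: "distinct q" using q by (auto simp: pth_def)
    have cq: "card (set q) = ?n" using dq by (simp add: distinct_card)
    have "card (NU - set q) + card (NV - set q) = card ((NU - set q) \<union> (NV - set q))"
      using False fin by (intro card_Un_disjoint[symmetric]) (auto simp: NU_def NV_def)
    also have "\<dots> \<le> card (V - set q)"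
      using fin by (intro card_mono) (auto simp: NU_def NV_def)
    also have "\<dots> = card V - ?n" using qV cq fin by (simp add: card_Diff_subset)
    finally have out: "card (NU - set q) + card (NV - set q) \<le> card V - ?n" .
    have "?n \<le> card V" using cq qV fin card_mono by metis
    moreover have "card NU = card (NU \<inter> set q) + card (NU - set q)"
      using fin by (metis (no_types, lifting) NU_def card_Int_Diff finite_Collect_conjI finite_subset mem_Collect_eq subsetI)
    moreover have "card NV = card (NV \<inter> set q) + card (NV - set q)"
      using fin by (metis (no_types, lifting) NV_def card_Int_Diff finite_Collect_conjI finite_subset mem_Collect_eq subsetI)
    ultimately have big: "card (NU \<inter> set q) + card (NV \<inter> set q) \<ge> ?n"
      using d out unfolding degree_def NU_def NV_def by linarith
    \<comment> \<open>Both sets index edges of the path, \<open>I\<close> by a chord from the first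
      vertex to the upper end, \<open>J\<close> by a chord from the last vertex to the lower end.
      There is one edge fewer than vertices, so they meet.\<close>
    define I J where "I = {i. Suc i < ?n \<and> E ?u (q ! Suc i)}" and "J = {i. Suc i < ?n \<and> E ?v (q ! i)}"
    have fIJ: "finite I" "finite J" unfolding I_def J_def by (auto intro: finite_subset[of _ "{..<?n}"])
    have "NU \<inter> set q \<subseteq> (\<lambda>i. q ! Suc i) ` I"
    proof
      fix y assume y: "y \<in> NU \<inter> set q"
      then obtain j where j: "j < ?n" "q ! j = y" by (meson IntD2 in_set_conv_nth)
      moreover have "j \<noteq> 0" using y j irr[of ?u] qn by (cases j) (auto simp: NU_def hd_conv_nth)
      ultimately show "y \<in> (\<lambda>i. q ! Suc i) ` I" using y
        by (intro image_eqI[of _ _ "j - 1"]) (auto simp: I_def NU_def)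
    qed
    then have cI: "card (NU \<inter> set q) \<le> card I"
      using fIJ surj_card_le by blast
    have "NV \<inter> set q \<subseteq> (\<lambda>i. q ! i) ` J"
    proof
      fix y assume y: "y \<in> NV \<inter> set q"
      then obtain j where j: "j < ?n" "q ! j = y" by (meson IntD2 in_set_conv_nth)
      moreover have "Suc j \<noteq> ?n"
      proof
        assume "Suc j = ?n"
        then have "?n - Suc 0 = j" by simp
        then show False using y j irr qn by (simp add: NV_def last_conv_nth)
      qed
      ultimately show "y \<in> (\<lambda>i. q ! i) ` J" using y
        by (intro image_eqI[of _ _ "j"]) (auto simp: J_def NV_def)
    qed
    then have cJ: "card (NV \<inter> set q) \<le> card J"
      using fIJ surj_card_le by blast
    have "I \<inter> J \<noteq> {}"
    proof
      assume "I \<inter> J = {}"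
      moreover have "I \<union> J \<subseteq> {..<?n - 1}"
        unfolding I_def J_def by auto
      ultimately have "card I + card J \<le> card {..<?n - 1}"
        using fIJ by (metis card_Un_disjoint card_mono finite_lessThan)
      then show False using big cI cJ qn q(2) by auto
    qed
    then obtain i where i: "Suc i < ?n" "E ?u (q ! Suc i)" "E ?v (q ! i)" unfolding I_def J_def by auto
    define A B where "A = take (Suc i) q" and "B = drop (Suc i) q"
    have AB: "q = A @ B" "A \<noteq> []" "B \<noteq> []" "last A = q ! i" "hd B = q ! Suc i"
      using i qn append_take_drop_id[of "Suc i" q]
      by (simp_all add: A_def B_def hd_drop_conv_nth) (simp_all add: take_Suc_conv_app_nth)
    have "cyc (A @ rev B)" using q i AB unfolding cyc_def pth_def
      by (auto simp: pcs intro: sym simp del: successively_rev)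
    then show ?thesis using AB by (intro exI[of _ "A @ rev B"]) auto
  qed
qed

end

section \<open>Inserting a vertex into a cycle\<close>

text \<open>If one of any two leaves of a claw is heavy, then two of the three are. In
  \<open>z2\<close> the pairs \<open>a, d\<close> and \<open>b, d\<close> have distance two via
  \<open>c\<close>, so \<open>d\<close> or both of \<open>a\<close> and \<open>b\<close> are heavy.
  The vertex \<open>e\<close> completes the induced P_4 or Z_2.\<close>

locale wgraph = sgraph +
  fixes W :: "'a set"
  assumes WV: "W \<subseteq> V"
    and claw: "\<lbrakk>c \<in> V; a \<in> V; b \<in> V; d \<in> V; E c a; E c b; E c d; a \<noteq> b; a \<noteq> d; b \<noteq> d;
      \<not> E a b; \<not> E a d; \<not> E b d\<rbrakk> \<Longrightarrow> a \<in> W \<and> b \<in> W \<or> a \<in> W \<and> d \<in> W \<or> b \<in> W \<and> d \<in> W"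
    and z2: "\<lbrakk>a \<in> V; b \<in> V; c \<in> V; d \<in> V; e \<in> V; E a b; E a c; E b c; E c d; E d e;
      \<not> E a d; \<not> E b d; \<not> E a e; \<not> E b e; \<not> E c e\<rbrakk> \<Longrightarrow> d \<in> W \<or> a \<in> W \<and> b \<in> W"
begin

text \<open>If the ends in the second alternative have a large degree sum, then \<open>ore_cycle\<close> turns the path into a cycle.\<close>

definition span :: "'a set \<Rightarrow> bool" where
  "span S \<longleftrightarrow> (\<exists>c. cyc c \<and> set c = S) \<or>
     (\<exists>q. pth q \<and> set q = S \<and> hd q \<in> W \<and> last q \<in> W \<and> hd q \<noteq> last q)"

lemma span_cyc: "cyc c \<Longrightarrow> set c = S \<Longrightarrow> span S"
  unfolding span_def by blast

lemma span_pth: "pth q \<Longrightarrow> set q = S \<Longrightarrow> hd q \<noteq> last q \<Longrightarrow> hd q \<in> W \<Longrightarrow> last q \<in> W \<Longrightarrow> span S"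
  unfolding span_def by blast

text \<open>A failed insertion of a light vertex. Exchanging \<open>a\<close> with \<open>b\<close>
  and reversing the cycle preserve it, so each fact below counts for all four cycle neighbours of
  \<open>a\<close> and \<open>b\<close>.\<close>

definition stuck :: "'a \<Rightarrow> 'a \<Rightarrow> 'a list \<Rightarrow> 'a \<Rightarrow> 'a list \<Rightarrow> bool" where
  "stuck x a A b B \<longleftrightarrow> cyc (a # A @ b # B) \<and> x \<in> V \<and> x \<notin> W \<and> x \<notin> set (a # A @ b # B) \<and> E x a \<and> E x b
     \<and> \<not> span (insert x (set (a # A @ b # B)))"

lemma stuck_swap: "stuck x a A b B \<Longrightarrow> stuck x b B a A"
  unfolding stuck_def using cyc_rotate[of "a # A" "b # B"] by (auto simp: insert_commute Un_commute)

lemma stuck_mirror: "stuck x a A b B \<Longrightarrow> stuck x a (rev B) b (rev A)"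
  unfolding stuck_def using cyc_rotate[of "rev B @ b # rev A" "[a]"] cyc_rev[of "a # A @ b # B"]
  by (auto simp: insert_commute Un_commute)

lemmas ds = cyc_def pth_def pcs

lemma distinct_by_set: "distinct ys \<Longrightarrow> set xs = set ys \<Longrightarrow> length xs = length ys \<Longrightarrow> distinct xs"
  by (metis card_distinct distinct_card)

lemma cyc_facts:
  assumes c: "cyc (a # A @ b # B)" and ne: "A \<noteq> []" "B \<noteq> []"
  shows "a \<in> V" "b \<in> V" "hd A \<in> V" "hd B \<in> V" "last A \<in> V" "last B \<in> V"
    "E a (hd A)" "E (last A) b" "E b (hd B)" "E (last B) a"
    "E (hd A) a" "E b (last A)" "E (hd B) b" "E a (last B)"
    "hd A \<noteq> hd B" "hd A \<noteq> last B" "last A \<noteq> hd B" "last A \<noteq> last B"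
    "hd A \<in> set A" "last A \<in> set A" "hd B \<in> set B" "last B \<in> set B"
    "set A \<inter> set B = {}"
proof -
  show m: "hd A \<in> set A" "last A \<in> set A" "hd B \<in> set B" "last B \<in> set B" using ne by auto
  show d: "set A \<inter> set B = {}" using c by (auto simp: ds)
  show "hd A \<noteq> hd B" "hd A \<noteq> last B" "last A \<noteq> hd B" "last A \<noteq> last B" using m d by (metis disjoint_iff)+
  show e: "E a (hd A)" "E (last A) b" "E b (hd B)" "E (last B) a" using c ne by (auto simp: ds)
  show "E (hd A) a" "E b (last A)" "E (hd B) b" "E a (last B)" using e sym by blast+
  have "set A \<subseteq> V" "set B \<subseteq> V" "a \<in> V" "b \<in> V" using c by (auto simp: ds)
  then show "a \<in> V" "b \<in> V" "hd A \<in> V" "hd B \<in> V" "last A \<in> V" "last B \<in> V" using m by blast+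
qed

text \<open>An empty arc or a forbidden edge would let \<open>x\<close> be absorbed. The vertices
  \<open>hd A\<close> and \<open>hd B\<close> are the ends of the crossing path through
  \<open>x\<close>, so they are neither adjacent nor both in \<open>W\<close>.\<close>

lemma stuck_basic:
  assumes s: "stuck x a A b B"
  shows "A \<noteq> []" "\<not> E x (hd A)" "\<not> E (hd A) (hd B)" "\<not> (hd A \<in> W \<and> hd B \<in> W)" "B \<noteq> []"
proof -
  let ?S = "insert x (set (a # A @ b # B))"
  have c: "cyc (a # A @ b # B)" and x: "x \<in> V" "x \<notin> set (a # A @ b # B)" "E x a" "E x b" "E a x" "E b x"
    and ns: "\<not> span ?S" using s sym by (auto simp: stuck_def)
  have "ear (set (a # A @ b # B)) [x] a b"
    using c x by (auto simp: ear_def pth_def cyc_def)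
  note ce = cyc_ear[OF c this]
  show A: "A \<noteq> []"
  proof
    assume "A = []"
    then show False using ns span_cyc[OF ce(1)] by (simp add: insert_commute)
  qed
  show B: "B \<noteq> []"
  proof
    assume "B = []"
    then show False using ns span_cyc[OF ce(2)] by (simp add: insert_commute)
  qed
  show "\<not> E x (hd A)"
  proof
    assume "E x (hd A)"
    then have "cyc (a # x # A @ b # B)" using c x A by (auto simp: ds)
    then show False using ns span_cyc by (metis insert_commute list.simps(15))
  qed
  have p: "pth (A @ b # x # a # rev B)" using ce(3) by simp
  have st: "set (A @ b # x # a # rev B) = ?S" by auto
  show "\<not> E (hd A) (hd B)"
  proof
    assume "E (hd A) (hd B)"
    then have "cyc (A @ b # x # a # rev B)" using p A B unfolding cyc_def by (auto simp: pcs sym_iff)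
    then show False using ns span_cyc st by metis
  qed
  show "\<not> (hd A \<in> W \<and> hd B \<in> W)"
  proof
    assume "hd A \<in> W \<and> hd B \<in> W"
    moreover have "hd A \<noteq> hd B" using cyc_facts[OF c A B] by blast
    ultimately show False using ns p st A B span_pth[OF p st] by (simp add: pcs)
  qed
qed

text \<open>Otherwise \<open>x\<close>, \<open>hd A\<close>, \<open>hd B\<close> are the leaves of a
  claw at \<open>b\<close>; as \<open>x\<close> is light, both others would be in
  \<open>W\<close>.\<close>

lemma stuck_nbr:
  assumes s: "stuck x a A b B"
  shows "\<not> E b (hd A)"
proof
  assume e: "E b (hd A)"
  note f = stuck_basic[OF s] stuck_basic[OF stuck_swap[OF s]]
  have "cyc (a # A @ b # B)" and x: "x \<in> V" "x \<notin> set (a # A @ b # B)" "E b x" "x \<notin> W"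
    using s sym by (auto simp: stuck_def)
  then have "b \<in> V" "hd A \<in> V" "hd B \<in> V" "E b (hd B)" "hd A \<noteq> hd B" "x \<noteq> hd A" "x \<noteq> hd B"
    using f(1,5) cyc_facts[of a A b B] by auto
  then show False using claw[of b x "hd A" "hd B"] x e f by blast
qed

lemma stuck_end:
  assumes s: "stuck x a A b B"
  shows "E (last B) (hd A) \<or> hd A \<in> W \<and> last B \<in> W"
proof (rule ccontr)
  assume n: "\<not> ?thesis"
  note f = stuck_basic[OF s] stuck_basic[OF stuck_mirror[OF s]]
  have "cyc (a # A @ b # B)" and x: "x \<in> V" "x \<notin> set (a # A @ b # B)" "E a x" "x \<notin> W"
    using s sym by (auto simp: stuck_def)
  then have "a \<in> V" "hd A \<in> V" "last B \<in> V" "E a (hd A)" "E a (last B)" "hd A \<noteq> last B" "x \<noteq> hd A" "x \<noteq> last B"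
    using f(1,5) cyc_facts[of a A b B] by auto
  then show False using claw[of a x "hd A" "last B"] x n f sym by (auto simp: hd_rev)
qed

text \<open>Follow \<open>A\<close> from \<open>hd A\<close> as long as the vertices see
  \<open>a\<close>. None of them sees \<open>x\<close> or \<open>b\<close>, but the last vertex of
  \<open>A\<close> sees \<open>b\<close>, so the process stops early. Where it stops, the triangle
  \<open>x, b, a\<close> with its tail forces the last vertex into \<open>W\<close>.\<close>

lemma stuck_half:
  assumes s: "stuck x a A b B" and e: "E (last B) (hd A)" and ab: "E a b"
  shows "\<exists>A1 A2. A = A1 @ A2 \<and> A1 \<noteq> [] \<and> last A1 \<in> W \<and> (\<forall>c\<in>set A1. E a c)"
proof -
  let ?S = "insert x (set (a # A @ b # B))"
  note f = stuck_basic[OF s] stuck_basic[OF stuck_swap[OF s]]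
  have c: "cyc (a # A @ b # B)" and x: "x \<in> V" "x \<notin> set (a # A @ b # B)" "x \<notin> W" "E x a" "E x b" "E a x" "E b x"
    and ns: "\<not> span ?S" using s sym by (auto simp: stuck_def)
  have V: "a \<in> V" "b \<in> V" "set A \<subseteq> V" "set B \<subseteq> V" and hB: "E b (hd B)" "hd B \<in> V"
    using c f by (auto simp: ds)
  have "?thesis" if "A = A1 @ A2" "A1 \<noteq> []" "\<forall>c\<in>set A1. E a c \<and> \<not> E b c \<and> \<not> E x c" for A1 A2
    using that
  proof (induction A2 arbitrary: A1)
    case Nil
    have "E b (last A1)" using c Nil by (auto simp: ds sym_iff)
    then show ?case using Nil by (metis last_in_set)
  next
    case (Cons d A2)
    have sA: "set A = insert d (set A1 \<union> set A2)" using Cons by auto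
    have l: "E a (last A1)" "\<not> E b (last A1)" "\<not> E x (last A1)" using Cons.prems by auto
    have c': "cyc (a # A1 @ d # A2 @ b # B)" using c Cons by simp
    have dV: "d \<in> V" "last A1 \<in> V" "E (last A1) d" "x \<noteq> d" "d \<noteq> hd B"
      using c' x Cons.prems f(5) V sA by (auto simp: ds)
    have lB: "E (last B) (hd A1)" using e Cons.prems by simp
    have "\<not> E x d"
    proof
      assume "E x d"
      then have "cyc (a # x # d # A2 @ b # B @ A1)"
        using c' x Cons.prems f(5) lB l by (auto simp: ds sym_iff)
      moreover have "set (a # x # d # A2 @ b # B @ A1) = ?S" using sA by auto
      ultimately show False using ns span_cyc by blast
    qed
    moreover have "\<not> E b d"
    proof
      assume bd: "E b d"
      \<comment> \<open>A claw at \<open>b\<close> with the light leaf \<open>x\<close>. Both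
        outcomes absorb \<open>x\<close>: the first by a cycle, the second by a spanning path from
        \<open>d\<close> to \<open>hd B\<close>.\<close>
      have "E d (hd B) \<or> d \<in> W \<and> hd B \<in> W"
        using claw[of b x d "hd B"] bd \<open>\<not> E x d\<close> x V hB dV f by (cases B) auto
      then show False
      proof
        assume "E d (hd B)"
        then have "cyc (a # x # b # rev (d # A2) @ B @ A1)"
          using c' x Cons.prems f(5) lB l by (auto simp: ds sym_iff simp del: successively_rev)
        moreover have "set (a # x # b # rev (d # A2) @ B @ A1) = ?S" using sA by auto
        ultimately show False using ns span_cyc by blast
      next
        assume w: "d \<in> W \<and> hd B \<in> W"
        have "pth ((d # A2) @ b # x # a # rev A1 @ rev B)"
          using c' x Cons.prems f(5) lB l by (auto simp: ds sym_iff simp del: successively_rev)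
        moreover have "set ((d # A2) @ b # x # a # rev A1 @ rev B) = ?S" using sA by auto
        ultimately show False using ns w dV f(5) span_pth by (auto simp: pcs)
      qed
    qed
    moreover have ?case if "E a d"
      using Cons.IH[of "A1 @ [d]"] Cons.prems that \<open>\<not> E x d\<close> \<open>\<not> E b d\<close> by auto
    moreover have ?case if "\<not> E a d"
    proof -
      have "last A1 \<in> W"
        using z2[of x b a "last A1" d] x V dV l calculation that ab sym by blast
      then show ?thesis using Cons.prems by blast
    qed
    ultimately show ?case by blast
  qed
  from this[of "[hd A]" "tl A"] show ?thesis
    using f(1,2) stuck_nbr[OF s] c by (auto simp: ds)
qed

text \<open>Checks the joints of the spanning path built in \<open>not_stuck_edge\<close>, where
  \<open>A\<close>, \<open>B\<close> and \<open>D\<close> may each be empty.\<close>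

lemma successively_chain:
  assumes "U \<noteq> []" "successively E U" "successively E B" "successively E A" "successively E D"
    and "B = [] \<Longrightarrow> E (last U) b" "B \<noteq> [] \<Longrightarrow> E (last U) (hd B)" "B \<noteq> [] \<Longrightarrow> E (last B) b"
    and "E b x" "E x a" "A \<noteq> [] \<Longrightarrow> E a (last A)" "E (hd (A @ [u])) (last (v # D))"
    and "E a (last (v # D))" "D \<noteq> [] \<Longrightarrow> E (hd D) v"
  shows "successively E (U @ B @ b # x # a # rev A @ rev D @ [v])"
  using assms by (cases "A = []"; cases "B = []"; cases "D = []")
    (simp_all add: pcs del: successively_rev)

lemma not_stuck_edge:
  assumes s: "stuck x a A b B" and e: "E (last B) (hd A)"
  shows False
proof -
  let ?S = "insert x (set (a # A @ b # B))"
  note s2 = stuck_swap[OF s]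
  note s3 = stuck_mirror[OF s]
  note s4 = stuck_mirror[OF s2]
  note f = stuck_basic[OF s] stuck_basic[OF s2] stuck_basic[OF s3] stuck_basic[OF s4]
  note g = stuck_nbr[OF s] stuck_nbr[OF s2] stuck_nbr[OF s3] stuck_nbr[OF s4]
  have c: "cyc (a # A @ b # B)" and x: "x \<in> V" "x \<notin> set (a # A @ b # B)" "x \<notin> W" "E x a" "E x b" "E a x" "E b x"
    and ns: "\<not> span ?S" using s sym by (auto simp: stuck_def)
  have V: "a \<in> V" "b \<in> V" "hd A \<in> V" "hd B \<in> V" "last A \<in> V" "last B \<in> V"
    "E a (hd A)" "E (last A) b" "E b (hd B)" "E (last B) a"
    using cyc_facts[OF c f(1,5)] by blast+
  have eb: "E (last A) (hd B) \<or> hd B \<in> W \<and> last A \<in> W" using stuck_end[OF s2] by simp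
  have f': "\<not> E x (last A)" "\<not> E x (last B)" "\<not> E b (last B)" "\<not> E a (last A)" "\<not> E b (hd A)" "\<not> E a (hd B)"
    "\<not> E x (hd A)" "\<not> E x (hd B)" "\<not> (hd A \<in> W \<and> hd B \<in> W)" "A \<noteq> []" "B \<noteq> []"
    using f g by (auto simp: hd_rev)
  show False
  proof (cases "E a b")
    case False
    \<comment> \<open>The triangle \<open>last B, hd A, a\<close> has the tail \<open>x, b\<close>,
      and \<open>x\<close> is light.\<close>
    have "hd A \<in> W" using z2[of "last B" "hd A" a x b] V e x f' False sym by blast
    moreover have "hd B \<in> W"
    proof (cases "E (last A) (hd B)")
      case True
      then show ?thesis using z2[of "last A" "hd B" b x a] V e x f' False sym by blast
    qed (use eb in blast)
    ultimately show False using f' by blast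
  next
    case True
    obtain A1 A2 where A: "A = A1 @ A2" "A1 \<noteq> []" "last A1 \<in> W" "\<forall>c\<in>set A1. E a c"
      using stuck_half[OF s e True] by blast
    \<comment> \<open>If \<open>last A\<close> and \<open>hd B\<close> are not adjacent, then
      \<open>hd B\<close> itself is in \<open>W\<close> and serves as a segment of length one; the
      path below then enters \<open>b\<close> from \<open>last A\<close> and does not need that
      edge.\<close>
    obtain B1 B2 where B: "B = B1 @ B2" "B1 \<noteq> []" "last B1 \<in> W" "\<forall>c\<in>set B1. E b c"
      "length B1 > 1 \<longrightarrow> E (last A) (hd B)"
    proof (cases "E (last A) (hd B)")
      case True
      then show thesis using stuck_half[OF s2 True] \<open>E a b\<close> sym that by blast
    next
      case False
      then show thesis using that[of "[hd B]" "tl B"] f' eb V by auto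
    qed
    obtain A' u where Au: "A1 = A' @ [u]" using A(2) by (metis rev_exhaust)
    obtain B' v where Bv: "B1 = B' @ [v]" using B(2) by (metis rev_exhaust)
    \<comment> \<open>This path joins the vertices \<open>u\<close> and \<open>v\<close> of
      \<open>W\<close>. It turns from \<open>A2\<close> into \<open>B'\<close> by the edge from
      \<open>last A\<close> to \<open>hd B\<close>, enters \<open>b\<close> and leaves
      \<open>a\<close> by the chords to the segments, and passes from \<open>A'\<close> to
      \<open>B2\<close> by the edge from \<open>hd A\<close> to \<open>last B\<close>.\<close>
    let ?q = "(u # A2) @ B' @ b # x # a # rev A' @ rev B2 @ [v]"
    have c': "cyc (a # A' @ u # A2 @ b # B' @ v # B2)" using c A B Au Bv by simp
    have lB: "E (last (v # B2)) (hd (A' @ [u]))" using e A B Au Bv by (cases A') auto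
    have lA: "B' \<noteq> [] \<longrightarrow> E (last (u # A2)) (hd B')" using A B Au Bv by (cases B') auto
    have eA: "E a u" "A' \<noteq> [] \<longrightarrow> E a (last A')" using A Au by auto
    have eB: "E b v" "B' \<noteq> [] \<longrightarrow> E b (last B')" using B Bv by auto
    have "pth ?q"
    proof -
      have d: "distinct (x # a # A' @ u # A2 @ b # B' @ v # B2)" "set ?q \<subseteq> V"
        using c' x A B Au Bv by (simp_all add: cyc_def pth_def)
      have "distinct ?q" by (rule distinct_by_set[OF d(1)]) auto
      moreover note d(2)
      moreover have s: "successively E (u # A2)" "successively E B'" "successively E A'" "successively E (v # B2)"
        "B' = [] \<Longrightarrow> E (last (u # A2)) b" "E (last (v # B2)) a"
        using c' unfolding ds by auto
      moreover have "successively E B2" "B2 \<noteq> [] \<Longrightarrow> E (hd B2) v"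
        using s(4) by (auto simp: successively_Cons sym_iff)
      moreover have "B' \<noteq> [] \<Longrightarrow> E (last B') b" "E a u" using eB eA sym by auto
      moreover have "E (hd (A' @ [u])) (last (v # B2))" "E a (last (v # B2))"
        using lB s(6) sym by blast+
      ultimately have "successively E ?q"
        using lA eA(2) x by (intro successively_chain) simp_all
      then show ?thesis using d(2) \<open>distinct ?q\<close> by (simp add: pth_def)
    qed
    moreover have "set ?q = ?S" using A B Au Bv by auto
    moreover have "hd ?q = u" "last ?q = v" "u \<noteq> v" using c' by (auto simp: ds)
    ultimately show False using ns span_pth A B Au Bv by (metis last_snoc)
  qed
qed

lemma not_stuck: "\<not> stuck x a A b B"
proof
  assume s: "stuck x a A b B"
  have "\<not> E (last B) (hd A)" using not_stuck_edge[OF s] by blast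
  moreover have "\<not> E (last A) (hd B)" using not_stuck_edge[OF stuck_swap[OF s]] by blast
  ultimately have "hd A \<in> W" "hd B \<in> W" using stuck_end[OF s] stuck_end[OF stuck_swap[OF s]] by auto
  then show False using stuck_basic(4)[OF s] by blast
qed

theorem insertion:
  assumes "cyc C" "x \<in> V - set C" "x \<notin> W" "a \<in> set C" "b \<in> set C" "a \<noteq> b" "E x a" "E x b"
  shows "span (insert x (set C))"
proof -
  obtain A B where "cyc (a # A @ b # B)" "set (a # A @ b # B) = set C" using cyc_at2 assms by metis
  then show ?thesis using not_stuck[of x a A b B] assms unfolding stuck_def by auto
qed

end

section \<open>Hamiltonicity\<close>

context sgraph
begin

text \<open>An ear on the two ends of an edge is closed to a cycle by that edge.\<close>

lemma exists_cyc:
  assumes tc: "two_connected V E"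
  shows "\<exists>c. cyc c"
proof -
  have c3: "card V \<ge> 3" and con: "connected_graph V E" using tc unfolding two_connected_def by auto
  obtain u where u: "u \<in> V" using c3 by fastforce
  have "card (V - {u}) \<ge> 2" using c3 u fin by simp
  then obtain v where v: "v \<in> V" "v \<noteq> u" by (metis Diff_empty Diff_insert0 card.empty card_gt_0_iff
        ex_in_conv insertCI insert_Diff nat_neq_iff not_numeral_le_zero DiffE singletonI)
  obtain p where p: "p \<noteq> []" "hd p = u" "pth p" "last p \<in> {v}"
    using connected_path_hit[OF con order_refl u, of "{v}" thesis] v by auto
  then obtain p' where p': "p = u # p'" "p' \<noteq> []" using v by (cases p) (auto split: if_splits)
  let ?w = "hd p'"
  have w: "E u ?w" "?w \<in> V" "?w \<noteq> u" using p p' by (auto simp: pth_def successively_Cons)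
  have "card (V - {u, ?w}) \<ge> 1" using c3 u w fin by (simp add: card_Diff_subset)
  then obtain x where x: "x \<in> V - {u, ?w}" by (metis card.empty ex_in_conv not_one_le_zero)
  obtain es a b where es: "ear {u, ?w} es a b"
    using ear_through[OF tc, of "{u, ?w}" x] u w x by auto
  have "E b a" using es w(1) sym by (auto simp: ear_def)
  then have "cyc (a # es @ [b])" using es u w by (cases es) (auto simp: ear_def cyc_def pth_def pcs)
  then show ?thesis by blast
qed

section \<open>Shortest ears\<close>

definition min_ear :: "'a set \<Rightarrow> 'a list \<Rightarrow> 'a \<Rightarrow> 'a \<Rightarrow> bool" where
  "min_ear S es a b \<longleftrightarrow> ear S es a b \<and> (\<forall>es' a' b'. ear S es' a' b' \<longrightarrow> length es \<le> length es')"

lemma min_ear_exists: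
  assumes "two_connected V E" "S \<subseteq> V" "card S \<ge> 2" "S \<noteq> V"
  shows "\<exists>es a b. min_ear S es a b"
proof -
  obtain x where "x \<in> V - S" using assms by auto
  then have "\<exists>n es a b. ear S es a b \<and> length es = n" using ear_through assms by blast
  then obtain es a b where "ear S es a b" "length es = (LEAST n. \<exists>es a b. ear S es a b \<and> length es = n)"
    by (smt (verit, best) LeastI_ex)
  then show ?thesis unfolding min_ear_def by (metis (mono_tags, lifting) Least_le)
qed

lemma min_ear_rev: "min_ear S es a b \<Longrightarrow> min_ear S (rev es) b a"
  unfolding min_ear_def using ear_rev by force

lemma min_ear_nbr:
  assumes "min_ear S es a b" "length es \<ge> 2" "x \<in> V - S" "c \<in> S" "d \<in> S" "E x c" "E x d"
  shows "c = d"
proof (rule ccontr)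
  assume "c \<noteq> d"
  then have "ear S [x] c d" using assms sym by (auto simp: ear_def pth_def)
  then show False using assms(1,2) unfolding min_ear_def by fastforce
qed

lemma min_ear_second:
  assumes m: "min_ear S (x # y # es) a b" and c: "c \<in> S" "E y c"
  shows "c = b \<and> es = []"
proof -
  have e: "ear S (x # y # es) a b" using m by (simp add: min_ear_def)
  have "c \<noteq> a"
  proof
    assume "c = a"
    then have "ear S (y # es) a b" using e c sym by (auto simp: ear_def pth_def pcs)
    then show False using m unfolding min_ear_def by fastforce
  qed
  then have "ear S [x, y] a c" using e c by (auto simp: ear_def pth_def pcs)
  then have "es = []" using m unfolding min_ear_def by fastforce
  moreover have "c = b"
    using min_ear_nbr[OF m, of y c b] e c \<open>es = []\<close> by (auto simp: ear_def pth_def)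
  ultimately show ?thesis by blast
qed

end

context wgraph
begin

text \<open>The light vertex \<open>x\<close> and the cycle neighbours of \<open>a\<close> form a
  claw, unless these are adjacent; then they form a triangle with \<open>a\<close>, and
  \<open>x, y\<close> is its tail. Both conditions put the two cycle neighbours into
  \<open>W\<close>.\<close>

lemma min_ear_end:
  assumes c: "cyc (a # A @ b # B)" and ne: "A \<noteq> []" "B \<noteq> []"
    and m: "min_ear (set (a # A @ b # B)) (x # y # es) a b" and x: "x \<notin> W"
  shows "hd A \<in> W \<and> last B \<in> W"
proof (rule ccontr)
  assume n: "\<not> ?thesis"
  let ?S = "set (a # A @ b # B)"
  note f = cyc_facts[OF c ne]
  have e: "ear ?S (x # y # es) a b" using m by (simp add: min_ear_def)
  have x': "x \<in> V - ?S" "E a x" "y \<in> V - ?S" "E x y" "E x a" using e sym by (auto simp: ear_def pth_def pcs)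
  have "b \<notin> set A" "b \<notin> set B" "a \<notin> set A" "a \<notin> set B" using c by (auto simp: cyc_def pth_def)
  then have nb: "hd A \<noteq> b" "last B \<noteq> b" "hd A \<noteq> a" "last B \<noteq> a" using f by metis+
  have S: "hd A \<in> ?S" "last B \<in> ?S" "a \<in> ?S" using f by auto
  have nx: "\<not> E x (hd A)" "\<not> E x (last B)"
    using min_ear_nbr[OF m _ x'(1) S(1) S(3) _ x'(5)] min_ear_nbr[OF m _ x'(1) S(2) S(3) _ x'(5)] nb by auto
  have ny: "\<not> E y (hd A)" "\<not> E y (last B)" "\<not> E y a"
    using min_ear_second[OF m S(1)] min_ear_second[OF m S(2)] min_ear_second[OF m S(3)] nb e
    by (auto simp only: ear_def)
  have neq: "x \<noteq> hd A" "x \<noteq> last B" using x' S by auto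
  have "E (last B) (hd A)"
    using claw[of a x "hd A" "last B"] f x' x n nx neq sym by blast
  then show False
    using z2[of "last B" "hd A" a x y] f x' x n nx ny sym by blast
qed

lemma span_superset:
  assumes deg: "\<And>u v. u \<in> W \<Longrightarrow> v \<in> W \<Longrightarrow> u \<noteq> v \<Longrightarrow> degree V E u + degree V E v \<ge> card V"
    and s: "span S" "card S \<ge> 3"
  shows "\<exists>c. cyc c \<and> S \<subseteq> set c"
  using s(1) unfolding span_def
proof
  assume "\<exists>q. pth q \<and> set q = S \<and> hd q \<in> W \<and> last q \<in> W \<and> hd q \<noteq> last q"
  then obtain q where q: "pth q" "set q = S" "hd q \<in> W" "last q \<in> W" "hd q \<noteq> last q" by blast
  moreover have "length q \<ge> 3" using q s(2) card_length[of q] by simp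
  ultimately show ?thesis using ore_cycle[of q] deg by blast
qed blast

theorem hamiltonian:
  assumes tc: "two_connected V E"
    and deg: "\<And>u v. u \<in> W \<Longrightarrow> v \<in> W \<Longrightarrow> u \<noteq> v \<Longrightarrow> degree V E u + degree V E v \<ge> card V"
  shows "\<exists>c. cyc c \<and> set c = V"
proof -
  \<comment> \<open>The factor \<open>card V + 1\<close> exceeds every second summand, so the order
    by \<open>\<mu>\<close> is lexicographic.\<close>
  define \<mu> where "\<mu> c = card (set c \<inter> W) * (card V + 1) + card (set c)" for c
  have cb: "card (set c \<inter> W) \<le> card V" "card (set c) \<le> card V" if "cyc c" for c
    using that fin by (auto simp: cyc_def pth_def intro!: card_mono)
  have "\<exists>c. cyc c \<and> (\<forall>d. cyc d \<longrightarrow> \<mu> d \<le> \<mu> c)"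
  proof -
    obtain c0 where "cyc c0" using exists_cyc[OF tc] by blast
    moreover have "\<mu> c \<le> card V * (card V + 1) + card V" if "cyc c" for c
      unfolding \<mu>_def by (intro add_mono mult_right_mono cb that) auto
    ultimately show ?thesis
      using ex_has_greatest_nat[of cyc c0 \<mu> "card V * (card V + 1) + card V + 1"] by (simp add: le_imp_less_Suc)
  qed
  then obtain C where C: "cyc C" and mx: "\<And>d. cyc d \<Longrightarrow> \<mu> d \<le> \<mu> C" by blast
  have m2: False if "cyc d" "set C \<inter> W \<union> {x} \<subseteq> set d \<inter> W" "x \<notin> set C" for d x
  proof -
    have "card (insert x (set C \<inter> W)) \<le> card (set d \<inter> W)" using that by (intro card_mono) auto
    then have "card (set C \<inter> W) + 1 \<le> card (set d \<inter> W)" using that by simp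
    then have "(card (set C \<inter> W) + 1) * (card V + 1) \<le> card (set d \<inter> W) * (card V + 1)"
      by (rule mult_right_mono) simp
    then have "\<mu> C < \<mu> d" using cb[OF C] unfolding \<mu>_def by simp
    then show False using mx that by fastforce
  qed
  have m1: False if "cyc d" "set C \<subseteq> set d" "z \<in> set d" "z \<notin> set C" for d z
  proof -
    have "set C \<subset> set d" using that by auto
    then have "card (set C) < card (set d)" by (simp add: psubset_card_mono)
    moreover have "card (set C \<inter> W) \<le> card (set d \<inter> W)" using that by (intro card_mono) auto
    then have "card (set C \<inter> W) * (card V + 1) \<le> card (set d \<inter> W) * (card V + 1)"
      by (rule mult_right_mono) simp
    ultimately have "\<mu> C < \<mu> d" unfolding \<mu>_def by simp
    then show False using mx that by fastforce
  qed
  have CV: "set C \<subseteq> V" and c3: "card (set C) \<ge> 3" using C by (auto simp: cyc_def pth_def distinct_card)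
  have WC: "W \<subseteq> set C"
  proof
    fix x assume xW: "x \<in> W"
    show "x \<in> set C"
    proof (rule ccontr)
      assume xC: "x \<notin> set C"
      obtain es a b where es: "ear (set C) es a b" and xe: "x \<in> set es"
        using ear_through[OF tc CV] c3 xC xW WV by fastforce
      have esp: "es \<noteq> []" "pth es" "set es \<inter> set C = {}" "E a (hd es)" "E (last es) b" "E (hd es) a" "E b (last es)"
        using es sym by (auto simp: ear_def)
      obtain A B where AB: "cyc (a # A @ b # B)" "set (a # A @ b # B) = set C"
        using cyc_at2[OF C] es unfolding ear_def by metis
      note ce = cyc_ear[OF AB(1) es[folded AB(2)]]
      \<comment> \<open>Replacing \<open>A\<close> by the ear loses only vertices of
        \<open>A\<close> and gains \<open>x\<close>; by maximality \<open>A\<close> must contain a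
        heavy vertex, and \<open>B\<close> likewise.\<close>
      have "\<exists>h\<in>set A. h \<in> W"
      proof (rule ccontr)
        assume "\<not> ?thesis"
        moreover have "cyc (a # es @ b # B)" using ce by simp
        ultimately show False using m2[of "a # es @ b # B" x] AB(2) xe xC xW by auto
      qed
      then obtain A1 h A2 where A: "A = A1 @ h # A2" "h \<in> W" "\<forall>z\<in>set A1. z \<notin> W"
        using split_list_first_prop[of A "\<lambda>z. z \<in> W"] by blast
      have "\<exists>h\<in>set B. h \<in> W"
      proof (rule ccontr)
        assume "\<not> ?thesis"
        moreover have "cyc (a # A @ b # rev es)" using ce by simp
        ultimately show False using m2[of "a # A @ b # rev es" x] AB(2) xe xC xW by auto
      qed
      then obtain B1 h' B2 where B: "B = B1 @ h' # B2" "h' \<in> W" "\<forall>z\<in>set B1. z \<notin> W"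
        using split_list_first_prop[of B "\<lambda>z. z \<in> W"] by blast
      \<comment> \<open>The crossing path shortened to heavy ends. What it omits of the cycle,
        \<open>A1\<close> and \<open>B1\<close>, is light, so closing it keeps all heavy vertices
        and adds \<open>x\<close>.\<close>
      let ?q = "(h # A2) @ b # rev es @ a # rev B2 @ [h']"
      have c': "cyc (a # A1 @ h # A2 @ b # B1 @ h' # B2)" using AB(1) A B by simp
      have d: "distinct (es @ a # A1 @ h # A2 @ b # B1 @ h' # B2)"
        using ce(4) unfolding A B by simp
      have "distinct ?q" using d by auto
      moreover have "set ?q \<subseteq> V" using CV AB(2) A B esp(2) by (auto simp: pth_def)
      moreover have "successively E ?q"
      proof -
        have "successively E (h # A2)" "successively E (h' # B2)" "E (last (h # A2)) b" "E (last (h' # B2)) a"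
          using c' unfolding ds by auto
        then have "successively E ((h # A2) @ b # rev es @ a # rev (h' # B2))"
          using esp by (intro successively_ear) (simp_all add: pth_def)
        then show ?thesis by simp
      qed
      ultimately have "pth ?q" by (simp add: pth_def)
      moreover have "length ?q \<ge> 3" by simp
      moreover have "h \<noteq> h'" using d by auto
      ultimately obtain c where c: "cyc c" "set ?q \<subseteq> set c"
        using ore_cycle[of ?q] deg[OF A(2) B(2)] by auto
      have "set C \<inter> W \<union> {x} \<subseteq> set c \<inter> W" using c(2) AB(2) A B xe xW by auto
      then show False using m2 c(1) xC by blast
    qed
  qed
  have "set C = V"
  proof (rule ccontr)
    assume "set C \<noteq> V"
    then obtain es a b where m: "min_ear (set C) es a b"
      using min_ear_exists[OF tc CV] c3 by fastforce
    then have es: "ear (set C) es a b" by (simp add: min_ear_def)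
    have esp: "es \<noteq> []" "pth es" "set es \<inter> set C = {}" "E a (hd es)" "E (last es) b" "E (hd es) a" "E b (last es)"
      "a \<in> set C" "b \<in> set C" "a \<noteq> b"
      using es sym by (auto simp: ear_def)
    have hes: "hd es \<in> set es" "hd es \<notin> set C" using esp(1,3) by (auto simp: disjoint_iff)
    have esW: "set es \<inter> W = {}" using esp WC by auto
    show False
    proof (cases "length es \<ge> 2")
      case False
      then obtain x where [simp]: "es = [x]" using esp(1) by (cases es rule: remdups_adj.cases) auto
      have "span (insert x (set C))" using esp esW sym C
        by (intro insertion[of C x a b]) (auto simp: pth_def)
      moreover have "card (insert x (set C)) \<ge> 3" using c3 esp by simp
      ultimately obtain d where "cyc d" "insert x (set C) \<subseteq> set d"
        using span_superset[OF deg] by blast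
      then show False using m1[of d x] esp by auto
    next
      case True
      then obtain x y zs where xy: "es = x # y # zs" by (cases es rule: remdups_adj.cases) auto
      have "length (rev es) \<ge> 2" using True by simp
      then obtain x' y' zs' where xy': "rev es = x' # y' # zs'" by (cases "rev es" rule: remdups_adj.cases) auto
      obtain A B where AB: "cyc (a # A @ b # B)" "set (a # A @ b # B) = set C"
        using cyc_at2[OF C] esp by metis
      note ce = cyc_ear[OF AB(1) es[folded AB(2)]]
      have A: "A \<noteq> []"
      proof
        assume "A = []"
        have "cyc (a # es @ b # B)" using ce by simp
        then show False using m1[of "a # es @ b # B" "hd es"] AB(2) hes \<open>A = []\<close> by auto
      qed
      have B: "B \<noteq> []"
      proof
        assume "B = []"
        have "cyc (a # A @ b # rev es)" using ce by simp
        then show False using m1[of "a # A @ b # rev es" "hd es"] AB(2) hes \<open>B = []\<close> by auto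
      qed
      have 1: "hd A \<in> W \<and> last B \<in> W"
        using min_ear_end[OF AB(1) A B, of x y zs] m esW unfolding AB(2) xy by auto
      have BA: "cyc (b # B @ a # A)" "set (b # B @ a # A) = set C"
        using cyc_rotate[of "a # A" "b # B"] AB by auto
      have "x' \<notin> W" using esW xy' by (metis disjoint_iff list.set_intros(1) set_rev)
      then have 2: "hd B \<in> W \<and> last A \<in> W"
        using min_ear_end[OF BA(1) B A, of x' y' zs'] min_ear_rev[OF m] unfolding BA(2) xy' by auto
      \<comment> \<open>Applied at both attachment points, \<open>min_ear_end\<close> makes both
        ends of the crossing path heavy.\<close>
      let ?q = "A @ b # rev es @ a # rev B"
      note f = cyc_facts[OF AB(1) A B]
      have "pth ?q" using ce by simp
      moreover have "length ?q \<ge> 3" using A by (cases A) auto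
      moreover have "hd ?q = hd A" "last ?q = hd B" using A B by (auto simp: pcs)
      ultimately obtain c where c: "cyc c" "set ?q \<subseteq> set c"
        using ore_cycle[of ?q] deg[of "hd A" "hd B"] 1 2 f by auto
      have "set C \<subseteq> set c" using c(2) unfolding AB(2)[symmetric] by auto
      then show False using m1[of c "hd es"] c hes by auto
    qed
  qed
  then show ?thesis using C by blast
qed

end

section \<open>Graphs without heavy vertices\<close>

context sgraph
begin

text \<open>On any cycle the two cycle edges exhaust the degree, so no ear can leave it and it spans
  the graph.\<close>

lemma max_degree_two_is_cycle_graph:
  assumes tc: "two_connected V E" and EV: "\<And>x y. E x y \<Longrightarrow> x \<in> V \<and> y \<in> V"
    and deg: "\<And>v. v \<in> V \<Longrightarrow> degree V E v \<le> 2"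
  shows "is_cycle_graph V E"
proof -
  obtain C where C: "cyc C" using exists_cyc[OF tc] by blast
  have two: "y = u \<or> y = v" if "E x u" "E x v" "u \<noteq> v" "E x y" for x y u v
  proof (rule ccontr)
    assume "\<not> ?thesis"
    then have "card {y, u, v} = 3" using that by auto
    moreover have "card {y, u, v} \<le> degree V E x"
      unfolding degree_def using that EV fin by (intro card_mono) auto
    ultimately show False using deg[of x] that EV by fastforce
  qed
  have closed: "y \<in> set C" if "x \<in> set C" "E x y" for x y
  proof -
    obtain C' where C': "cyc (x # C')" "set (x # C') = set C" using cyc_at[OF C \<open>x \<in> set C\<close>] by metis
    then have l: "length C' \<ge> 2" by (simp add: cyc_def)
    then obtain p q where pq: "C' = p # q" "q \<noteq> []" by (cases C' rule: remdups_adj.cases) auto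
    have "E x p" "E (last q) x" "p \<noteq> last q" using C' pq last_in_set[OF pq(2)] by (auto simp: cyc_def pth_def successively_Cons)
    then have "y = p \<or> y = last q" using two that sym by blast
    then have "y \<in> set (x # C')" using pq last_in_set[OF pq(2)] by auto
    then show ?thesis unfolding C'(2) .
  qed
  have CV: "set C = V"
  proof (rule ccontr)
    assume n: "set C \<noteq> V"
    have "set C \<subseteq> V" "card (set C) \<ge> 2" using C by (auto simp: cyc_def pth_def distinct_card)
    then obtain es a b where "min_ear (set C) es a b" using min_ear_exists[OF tc] n by blast
    then have "ear (set C) es a b" by (simp add: min_ear_def)
    then have "a \<in> set C" "E a (hd es)" "hd es \<in> set es" "set es \<inter> set C = {}" by (auto simp: ear_def)
    then show False using closed by blast
  qed
  let ?L = "length C"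
  have L: "?L \<ge> 3" and dC: "distinct C" using C by (auto simp: cyc_def pth_def)
  have nxt: "E (C ! i) (C ! (Suc i mod ?L))" if "i < ?L" for i
    using cyc_imp_is_cycle[OF C] that by (auto simp: is_cycle_def)
  have "E x y \<longleftrightarrow> (\<exists>i<?L. (x = C ! i \<and> y = C ! (Suc i mod ?L)) \<or> (y = C ! i \<and> x = C ! (Suc i mod ?L)))" for x y
  proof
    assume e: "E x y"
    then obtain i where i: "i < ?L" "x = C ! i" using EV CV by (metis in_set_conv_nth)
    define j where "j = (if i = 0 then ?L - 1 else i - 1)"
    have j: "j < ?L" "Suc j mod ?L = i" using i L by (auto simp: j_def)
    have "j \<noteq> Suc i mod ?L" using i L by (cases "Suc i = ?L") (auto simp: j_def)
    moreover have "Suc i mod ?L < ?L" using i(1) by (intro mod_less_divisor) linarith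
    ultimately have "C ! j \<noteq> C ! (Suc i mod ?L)" using dC j(1) by (simp add: nth_eq_iff_index_eq)
    moreover have "E x (C ! (Suc i mod ?L))" "E x (C ! j)" using nxt[OF i(1)] nxt[OF j(1)] i j sym by auto
    ultimately have "y = C ! (Suc i mod ?L) \<or> y = C ! j" using two e by blast
    then show "\<exists>i<?L. (x = C ! i \<and> y = C ! (Suc i mod ?L)) \<or> (y = C ! i \<and> x = C ! (Suc i mod ?L))"
      using i j by metis
  qed (use nxt sym in blast)
  then show ?thesis unfolding is_cycle_graph_def using cyc_imp_is_cycle[OF C] CV by blast
qed

lemma cyc_length: "cyc c \<Longrightarrow> length c = card (set c)"
  by (simp add: cyc_def pth_def distinct_card)

end

context wgraph
begin

text \<open>The ear cannot simply be inserted, as the length must grow by exactly one. A claw at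
  \<open>a\<close> and a Z_2 show that it has two vertices. If the cycle is a triangle, they replace
  its third vertex; otherwise further claws at \<open>b\<close> and \<open>a\<close> lead to a
  forbidden Z_2.\<close>

lemma extend_adjacent_ear:
  assumes W: "W = {}" and c: "cyc (a # b # B)" and m: "min_ear (set (a # b # B)) (x # y # es) a b"
  shows "\<exists>d. cyc d \<and> length d = length B + 3"
proof -
  let ?S = "set (a # b # B)"
  have B: "B \<noteq> []" using c by (auto simp: cyc_def)
  have e: "ear ?S (x # y # es) a b" using m by (simp add: min_ear_def)
  have x': "x \<in> V - ?S" "E a x" "y \<in> V - ?S" "E x y" "E x a" "x \<noteq> y" "E y x" "a \<noteq> b"
    using e sym by (auto simp: ear_def pth_def pcs)
  have cf: "a \<in> V" "b \<in> V" "hd B \<in> set B" "last B \<in> set B" "E a b" "E b (hd B)" "E (last B) a" "a \<notin> set B" "b \<notin> set B"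
    "set B \<subseteq> V"
    using c B by (auto simp: cyc_def pth_def pcs)
  have nb: "hd B \<noteq> b" "last B \<noteq> b" "hd B \<noteq> a" "last B \<noteq> a" using cf by metis+
  have S: "hd B \<in> ?S" "last B \<in> ?S" "a \<in> ?S" "b \<in> ?S" using cf by auto
  have nx: "\<not> E x b" "\<not> E x (last B)" "\<not> E x (hd B)"
    using min_ear_nbr[OF m _ x'(1) S(4) S(3) _ x'(5)] min_ear_nbr[OF m _ x'(1) S(1) S(3) _ x'(5)]
      min_ear_nbr[OF m _ x'(1) S(2) S(3) _ x'(5)] nb x'(8) by auto
  have ny: "\<not> E y (hd B)" "\<not> E y (last B)" "\<not> E y a"
    using min_ear_second[OF m S(1)] min_ear_second[OF m S(2)] min_ear_second[OF m S(3)] nb x'(8) by auto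
  have V: "hd B \<in> V" "last B \<in> V" "x \<in> V" "y \<in> V" using cf x' by auto
  have neq: "x \<noteq> b" "x \<noteq> hd B" "x \<noteq> last B" "y \<noteq> a" "y \<noteq> hd B" using x' S by auto
  have "E (last B) b"
    using claw[of a x b "last B"] V cf nx nb neq x' W sym by blast
  then have "E y b"
    using z2[of "last B" b a x y] V cf nx ny x' W sym by blast
  then have es: "es = []" using min_ear_second[OF m S(4)] by simp
  show ?thesis
  proof (cases "hd B = last B")
    case True
    have "cyc [a, x, y, b]"
      using cf x' V neq \<open>E y b\<close> sym by (auto simp: cyc_def pth_def)
    moreover have "length B = 1"
    proof -
      obtain p q where "B = p # q" using B by (cases B) auto
      moreover have "q = []" using True c \<open>B = p # q\<close> by (cases q rule: rev_cases) (auto simp: cyc_def pth_def)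
      ultimately show ?thesis by simp
    qed
    ultimately show ?thesis by (intro exI[of _ "[a, x, y, b]"]) simp
  next
    case False
    have "E a (hd B)"
      using claw[of b y a "hd B"] V cf ny nb neq x' W \<open>E y b\<close> sym by blast
    moreover have o: "E a (last B)" "E (last B) a" using cf sym by auto
    moreover have "E (last B) (hd B)"
      using claw[of a x "last B" "hd B"] V(1-3) cf(1) nx(2,3) neq(2,3) x'(2) W False calculation(1) o(1) by auto
    ultimately have False
      using z2[of "last B" "hd B" a x y] V cf(1) nx(2,3) ny x'(2,4) W sym[of a "hd B"] sym[of "last B" y] sym[of "hd B" y] sym[of a y] sym[of "last B" x] sym[of "hd B" x] by auto
    then show ?thesis ..
  qed
qed

text \<open>Without heavy vertices \<open>span\<close> always means a cycle, and
  \<open>min_ear_end\<close> rules out a long shortest ear whose ends are not consecutive on the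
  cycle.\<close>

lemma extend_cyc:
  assumes W: "W = {}" and tc: "two_connected V E" and C: "cyc C" "set C \<noteq> V"
  shows "\<exists>d. cyc d \<and> length d = Suc (length C)"
proof -
  have CV: "set C \<subseteq> V" "card (set C) \<ge> 2" using C by (auto simp: cyc_def pth_def distinct_card)
  obtain es a b where m: "min_ear (set C) es a b" using min_ear_exists[OF tc CV C(2)] by blast
  then have es: "ear (set C) es a b" by (simp add: min_ear_def)
  show ?thesis
  proof (cases "length es \<ge> 2")
    case False
    then obtain x where [simp]: "es = [x]" using es by (cases es rule: remdups_adj.cases) (auto simp: ear_def)
    have "span (insert x (set C))" using es C W sym
      by (intro insertion[of C x a b]) (auto simp: ear_def pth_def)
    then obtain d where d: "cyc d" "set d = insert x (set C)" unfolding span_def using W by auto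
    have "x \<notin> set C" using es by (auto simp: ear_def)
    then show ?thesis using d cyc_length[OF d(1)] cyc_length[OF C(1)] by auto
  next
    case True
    then obtain x y zs where xy: "es = x # y # zs" by (cases es rule: remdups_adj.cases) auto
    have "length (rev es) \<ge> 2" using True by simp
    then obtain x' y' zs' where xy': "rev es = x' # y' # zs'" by (cases "rev es" rule: remdups_adj.cases) auto
    obtain A B where AB: "cyc (a # A @ b # B)" "set (a # A @ b # B) = set C"
      using cyc_at2[OF C(1)] es unfolding ear_def by metis
    have BA: "cyc (b # B @ a # A)" "set (b # B @ a # A) = set C"
      using cyc_rotate[of "a # A" "b # B"] AB by auto
    have L: "length C = length A + length B + 2"
      using cyc_length[OF AB(1)] cyc_length[OF C(1)] AB(2) by simp
    consider "A \<noteq> []" "B \<noteq> []" | "A = []" | "B = []" by blast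
    then show ?thesis
    proof cases
      case 1
      then show ?thesis using min_ear_end[OF AB(1) 1, of x y zs] m W unfolding AB(2) xy by auto
    next
      case 2
      then show ?thesis using extend_adjacent_ear[OF W, of a b B x y zs] AB m L unfolding xy by auto
    next
      case 3
      then show ?thesis using extend_adjacent_ear[OF W, of b a A x' y' zs'] BA min_ear_rev[OF m] L unfolding xy' by auto
    qed
  qed
qed

theorem pancyclic_if_W_empty:
  assumes W: "W = {}" and tc: "two_connected V E" and EV: "\<And>x y. E x y \<Longrightarrow> x \<in> V \<and> y \<in> V"
    and nc: "\<not> is_cycle_graph V E"
  shows "pancyclic V E"
proof (rule pancyclicI)
  fix k :: nat assume k: "3 \<le> k" "k \<le> card V"
  from k show "has_len k"
  proof (induction k rule: nat_induct_at_least)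
    case base
    obtain v where v: "v \<in> V" "degree V E v \<ge> 3"
      using max_degree_two_is_cycle_graph[OF tc EV] nc by fastforce
    then obtain T where T: "T \<subseteq> {y \<in> V. E v y}" "card T = 3"
      using obtain_subset_with_card_n unfolding degree_def by metis
    then obtain p q r where pqr: "T = {p, q, r}" "p \<noteq> q" "p \<noteq> r" "q \<noteq> r" by (auto simp: card_3_iff)
    then have e: "E v p" "E v q" "E v r" "p \<in> V" "q \<in> V" "r \<in> V" using T by auto
    then have "E p q \<or> E p r \<or> E q r" using claw[of v p q r] v pqr W by blast
    then have "\<exists>s t. E v s \<and> E v t \<and> E s t \<and> s \<in> V \<and> t \<in> V" using e by blast
    then obtain s t where "E v s" "E v t" "E s t" "s \<in> V" "t \<in> V" by blast
    then have "cyc [v, s, t]" using v sym irr by (auto simp: cyc_def pth_def)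
    then show ?case unfolding has_len_def by (intro exI[of _ "[v, s, t]"]) simp
  next
    case (Suc k)
    then obtain c where c: "cyc c" "length c = k" unfolding has_len_def by auto
    then have "set c \<noteq> V" using cyc_length Suc.prems by fastforce
    then show ?case using extend_cyc[OF W tc] c unfolding has_len_def by metis
  qed
qed

end

section \<open>Cycles of all lengths from heavy vertices\<close>

lemma shift_mod_inj: "inj_on (\<lambda>i. (i + m) mod N) {..<N::nat}"
proof -
  have *: "i = j" if "i < N" "j < N" "(i + m) mod N = (j + m) mod N" "i \<le> j" for i j
  proof -
    have "N dvd (j + m) - (i + m)" using that mod_eq_dvd_iff_nat[of "i + m" "j + m" N] by simp
    then show ?thesis using that by (auto dest: dvd_imp_le)
  qed
  show ?thesis by (rule inj_onI) (metis * lessThan_iff nat_le_linear)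
qed

text \<open>The target \<open>T\<close> is left general because \<open>heavy_around_triangle\<close>
  must exclude one position to win the count.\<close>

lemma shift_mod_meet:
  assumes "I \<subseteq> {..<N::nat}" "finite T" "J \<subseteq> T" "(\<lambda>i. (i + m) mod N) ` I \<subseteq> T" "card I + card J > card T"
  shows "\<exists>i\<in>I. (i + m) mod N \<in> J"
proof (rule ccontr)
  let ?K = "(\<lambda>i. (i + m) mod N) ` I"
  assume "\<not> ?thesis"
  then have "?K \<inter> J = {}" by auto
  moreover have "finite ?K" "finite J" using assms finite_subset by blast+
  ultimately have "card ?K + card J = card (?K \<union> J)" by (simp add: card_Un_disjoint)
  also have "\<dots> \<le> card T" using assms by (intro card_mono) auto
  finally show False using assms(5) card_image[OF inj_on_subset[OF shift_mod_inj assms(1)]] by simp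
qed

lemma card_nth_filter:
  assumes "distinct ps"
  shows "card {i. i < length ps \<and> P (ps ! i)} = card {x \<in> set ps. P x}"
proof -
  have "bij_betw ((!) ps) {i. i < length ps \<and> P (ps ! i)} {x \<in> set ps. P x}"
    using assms by (auto simp: bij_betw_def inj_on_def nth_eq_iff_index_eq in_set_conv_nth)
  then show ?thesis by (rule bij_betw_same_card)
qed

context sgraph
begin

lemma pth_append: "pth (xs @ ys) \<longleftrightarrow> pth xs \<and> pth ys \<and> set xs \<inter> set ys = {}
    \<and> (xs = [] \<or> ys = [] \<or> E (last xs) (hd ys))"
  by (auto simp: pth_def successively_append_iff)

lemma pth_Cons: "pth (x # ys) \<longleftrightarrow> x \<in> V \<and> x \<notin> set ys \<and> pth ys \<and> (ys = [] \<or> E x (hd ys))"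
  by (auto simp: pth_def successively_Cons)

lemma pth_take_drop: "pth ps \<Longrightarrow> pth (take m (drop j ps))"
  by (metis append_take_drop_id pth_append)

lemma pth_take: "pth ps \<Longrightarrow> pth (take m ps)"
  by (metis append_take_drop_id pth_append)

lemma pth_drop: "pth ps \<Longrightarrow> pth (drop m ps)"
  by (metis append_take_drop_id pth_append)

lemma has_lenI: "cyc c \<Longrightarrow> length c = k \<Longrightarrow> has_len k"
  unfolding has_len_def by blast

lemma spanning_length: "cyc c \<Longrightarrow> set c = V \<Longrightarrow> length c = card V"
  by (metis cyc_def pth_def distinct_card)

text \<open>The neighbours of \<open>h\<close> fill more than half of the positions of
  \<open>D\<close>, so this set meets each of its shifts.\<close>

lemma has_len_missing:
  assumes D: "cyc D" and h: "h \<in> V" "h \<notin> set D" and d: "2 * card {x \<in> set D. E h x} > length D"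
    and k: "3 \<le> k" "k \<le> Suc (length D)"
  shows "has_len k"
proof -
  let ?L = "length D"
  \<comment> \<open>An arc between two positions at distance \<open>s\<close> has
    \<open>s + 1\<close> vertices, and \<open>h\<close> is one more.\<close>
  define s where "s = k - 2"
  define A where "A = {i. i < ?L \<and> E h (D ! i)}"
  have s: "1 \<le> s" "s < ?L" "k = s + 2" using k by (auto simp: s_def)
  have D0: "D \<noteq> []" using D by (auto simp: cyc_def)
  have dD: "distinct D" using D by (simp add: cyc_def pth_def)
  have "card A = card {x \<in> set D. E h x}" unfolding A_def by (rule card_nth_filter[OF dD])
  moreover have "(\<lambda>i. (i + s) mod ?L) ` A \<subseteq> {..<?L}" using s(2) by (auto intro!: mod_less_divisor)
  ultimately have "\<exists>i\<in>A. (i + s) mod ?L \<in> A"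
    using d by (intro shift_mod_meet[of A ?L "{..<?L}" A s]) (auto simp: A_def)
  then obtain i where i: "i < ?L" "E h (D ! i)" "E h (D ! ((i + s) mod ?L))" unfolding A_def by auto
  let ?R = "rotate i D"
  have "cyc ?R" unfolding rotate_drop_take using cyc_rotate D by (metis append_take_drop_id)
  then have p: "pth (take (Suc s) ?R)" using pth_take by (auto simp: cyc_def)
  have hd: "hd (take (Suc s) ?R) = D ! i"
    using i D0 nth_rotate[of 0 D i] by (simp add: hd_conv_nth)
  have "last (take (Suc s) ?R) = ?R ! s" using s(2) by (simp add: take_Suc_conv_app_nth)
  then have l: "last (take (Suc s) ?R) = D ! ((i + s) mod ?L)" using s nth_rotate[of s D i] by simp
  have "set (take (Suc s) ?R) \<subseteq> set D" by (metis set_rotate set_take_subset)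
  then have "cyc (h # take (Suc s) ?R)"
    using p hd l h i s sym unfolding cyc_def pth_Cons by auto
  then show ?thesis using s by (intro has_lenI[of "h # take (Suc s) ?R"]) auto
qed

text \<open>The pairing of Hakimi and Schmeichel: each position \<open>i\<close> has one partner \<open>j\<close> such that
  chords from \<open>h\<close> to \<open>i\<close> and from \<open>g\<close> to \<open>j\<close> close up to a cycle of the given length.\<close>

lemma two_ends_cycle:
  assumes p: "pth ps" and hg: "h \<in> V" "g \<in> V" "h \<noteq> g" "h \<notin> set ps" "g \<notin> set ps" "E h g"
    and e: "E g (hd ps)" "E (last ps) h"
    and ij: "i < length ps" "j < length ps" "E h (ps ! i)" "E g (ps ! j)"
    and c: "c < length ps" "j = (i + (length ps - c)) mod length ps"
  shows "has_len (c + 3)"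
proof (cases "c \<le> i")
  case True
  have "i + (length ps - c) = (i - c) + length ps" using True c by simp
  then have "j = ((i - c) + length ps) mod length ps" using c(2) by (simp only:)
  then have j: "j = i - c" using ij(1) by simp
  \<comment> \<open>The block from position \<open>j = i - c\<close> to \<open>i\<close> has
    \<open>c + 1\<close> vertices; \<open>h\<close> and \<open>g\<close> make
    \<open>c + 3\<close>.\<close>
  let ?q = "take (Suc c) (drop j ps)"
  have l: "length ?q = Suc c" using j ij True by simp
  have ne: "?q \<noteq> []" using l by auto
  have "hd ?q = ps ! j" using ij(2) by (simp add: hd_drop_conv_nth)
  moreover have "last ?q = ps ! i" using l ne j True ij by (simp add: last_conv_nth)
  moreover have "set ?q \<subseteq> set ps" by (meson set_take_subset set_drop_subset order_trans)
  ultimately have "cyc (h # g # ?q)"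
    using hg ij l ne pth_take_drop[OF p, of "Suc c" j] sym unfolding cyc_def pth_Cons by auto
  then show ?thesis using l by (intro has_lenI[of "h # g # ?q"]) auto
next
  case False
  have "i + (length ps - c) < length ps" using False c ij by simp
  then have j: "j = i + (length ps - c)" using c(2) by simp
  \<comment> \<open>The partner lies behind \<open>i\<close>: the first \<open>i + 1\<close> and the
    last \<open>c - i\<close> vertices are kept, again \<open>c + 1\<close> in all.\<close>
  let ?q = "h # rev (take (Suc i) ps) @ g # drop j ps"
  have ne: "ps \<noteq> []" using ij by auto
  have 1: "hd (rev (take (Suc i) ps)) = ps ! i" "last (rev (take (Suc i) ps)) = hd ps"
    using ij(1) ne by (simp_all add: hd_rev last_rev take_Suc_conv_app_nth) (cases ps; simp)
  have 2: "hd (drop j ps) = ps ! j" "last (drop j ps) = last ps" "drop j ps \<noteq> []"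
    using ij(2) by (simp_all add: hd_drop_conv_nth)
  have dj: "set (take (Suc i) ps) \<inter> set (drop j ps) = {}"
    using p j c False by (intro set_take_disj_set_drop_if_distinct) (auto simp: pth_def)
  have sub: "set (take (Suc i) ps) \<subseteq> set ps" "set (drop j ps) \<subseteq> set ps" by (rule set_take_subset, rule set_drop_subset)
  have "pth (g # drop j ps)" using hg sub pth_drop[OF p] ij 2 unfolding pth_Cons by auto
  moreover have "pth (rev (take (Suc i) ps))" using pth_take[OF p] pth_rev by blast
  ultimately have "pth (rev (take (Suc i) ps) @ g # drop j ps)"
    using 1 e(1) sym dj sub hg unfolding pth_append by auto
  then have "pth ?q" using hg sub 1 ij ne unfolding pth_Cons by auto
  then have "cyc ?q" using e 2 unfolding cyc_def by auto
  then show ?thesis using j c False ij by (intro has_lenI[of ?q]) auto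
qed

text \<open>Outside \<open>ps\<close> each of \<open>h\<close> and \<open>g\<close> has only the
  other as a neighbour, so \<open>card V + 1 - 2\<close> chord ends remain on
  \<open>card V - 2\<close> positions, one more than fits without a pair.\<close>

lemma consecutive_heavy:
  assumes c: "cyc (h # g # ps)" "set (h # g # ps) = V" and d: "degree V E h + degree V E g \<ge> card V + 1"
  shows "pancyclic V E"
proof (rule pancyclicI)
  fix k assume k: "3 \<le> k" "k \<le> card V"
  let ?N = "length ps"
  have ne: "ps \<noteq> []" using c by (auto simp: cyc_def)
  have n: "card V = ?N + 2" using spanning_length[OF c] by simp
  have f: "h \<in> V" "g \<in> V" "h \<noteq> g" "h \<notin> set ps" "g \<notin> set ps" "E h g" "E g (hd ps)" "E (last ps) h" "pth ps"
    using c ne by (auto simp: cyc_def pth_Cons)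
  have Ns: "{y \<in> V. E h y} = insert g {x \<in> set ps. E h x}" "{y \<in> V. E g y} = insert h {x \<in> set ps. E g x}"
    using c f irr sym by auto
  define I J where "I = {i. i < ?N \<and> E h (ps ! i)}" and "J = {i. i < ?N \<and> E g (ps ! i)}"
  have "card I = card {x \<in> set ps. E h x}" "card J = card {x \<in> set ps. E g x}"
    unfolding I_def J_def using f(9) by (intro card_nth_filter; simp add: pth_def)+
  then have IJ: "card I + card J > ?N" using d f n unfolding degree_def Ns by simp
  have "(\<lambda>i. (i + (?N - (k - 3))) mod ?N) ` I \<subseteq> {..<?N}" using ne by auto
  then have "\<exists>i\<in>I. (i + (?N - (k - 3))) mod ?N \<in> J"
    using IJ by (intro shift_mod_meet[of I ?N "{..<?N}"]) (auto simp: I_def J_def)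
  then obtain i where "i \<in> I" "(i + (?N - (k - 3))) mod ?N \<in> J" by blast
  then have "has_len ((k - 3) + 3)" unfolding I_def J_def
    using two_ends_cycle[OF f(9) f(1-8), of i _ "k - 3"] k n by auto
  then show "has_len k" using k by simp
qed

text \<open>Here \<open>y\<close> costs two more chord ends, but only one position, so the count
  only reaches the number of positions. The missing one comes from the last position, which
  \<open>g\<close> does not see, and from the detour through \<open>y\<close>.\<close>

lemma heavy_around_triangle:
  assumes c: "cyc (h # y # g # ps)" "set (h # y # g # ps) = V" and ne: "ps \<noteq> []"
    and hg: "E h g" and l: "\<not> E g (last ps)"
    and d: "degree V E h + degree V E g \<ge> card V + 1"
  shows "pancyclic V E"
proof (rule pancyclicI)
  fix k assume k: "3 \<le> k" "k \<le> card V"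
  let ?N = "length ps"
  have n: "card V = ?N + 3" using spanning_length[OF c] by simp
  have f: "h \<in> V" "g \<in> V" "h \<noteq> g" "h \<notin> set ps" "g \<notin> set ps" "E h g" "E g (hd ps)" "E (last ps) h" "pth ps"
    using c ne hg by (auto simp: cyc_def pth_Cons)
  have y: "y \<in> V" "y \<notin> set ps" "y \<noteq> h" "y \<noteq> g" "E h y" "E y g" "E y h" "E g y"
    using c ne sym by (auto simp: cyc_def pth_Cons)
  have Ns: "{y \<in> V. E h y} = insert y (insert g {x \<in> set ps. E h x})" "{y \<in> V. E g y} = insert y (insert h {x \<in> set ps. E g x})"
    using c f y irr sym by auto
  define I J where "I = {i. i < ?N \<and> E h (ps ! i)}" and "J = {i. i < ?N \<and> E g (ps ! i)}"
  have "card I = card {x \<in> set ps. E h x}" "card J = card {x \<in> set ps. E g x}"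
    unfolding I_def J_def using f(9) by (intro card_nth_filter; simp add: pth_def)+
  then have IJ: "card I + card J \<ge> ?N" using d f y n unfolding degree_def Ns by simp
  consider "k = card V" | "k = 3" | "4 \<le> k" "k < card V" using k by linarith
  then show "has_len k"
  proof cases
    case 1
    then show ?thesis using has_lenI[OF c(1)] spanning_length[OF c] by simp
  next
    case 2
    have "cyc [h, y, g]" using f y sym by (auto simp: cyc_def pth_def)
    then show ?thesis using 2 has_lenI[of "[h, y, g]" k] by simp
  next
    case 3
    define r where "r = k - 3"
    have r: "1 \<le> r" "r < ?N" "k = r + 3" using 3 n by (auto simp: r_def)
    show ?thesis
    \<comment> \<open>If \<open>h\<close> sees position \<open>r - 1\<close>, the route through
      \<open>y\<close> has the required length. If not, \<open>I\<close> avoids the only position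
      that the shift sends to the last one, and neither the shifted \<open>I\<close> nor
      \<open>J\<close> uses that position.\<close>
    proof (cases "r - 1 \<in> I")
      case True
      let ?q = "take r ps"
      have "?q \<noteq> []" "hd ?q = hd ps" "last ?q = ps ! (r - 1)" "set ?q \<subseteq> set ps"
        using r ne set_take_subset[of r ps] by (auto simp: last_conv_nth)
      then have "cyc (h # y # g # ?q)"
        using True f y sym pth_take[OF f(9), of r] unfolding cyc_def pth_Cons I_def by auto
      then show ?thesis using r by (intro has_lenI[of "h # y # g # ?q"]) auto
    next
      case False
      let ?T = "{..<?N} - {?N - 1}"
      have jn: "?N - 1 \<notin> J" using l ne by (simp add: J_def last_conv_nth)
      have "(\<lambda>i. (i + (?N - r)) mod ?N) ` I \<subseteq> ?T"
      proof
        fix z assume "z \<in> (\<lambda>i. (i + (?N - r)) mod ?N) ` I"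
        then obtain i where i: "i \<in> I" "z = (i + (?N - r)) mod ?N" by blast
        have "(r - 1) + (?N - r) = ?N - 1" using r by simp
        then have "((r - 1) + (?N - r)) mod ?N = ?N - 1" using r by simp
        then have "z \<noteq> ?N - 1"
          using inj_onD[OF shift_mod_inj[of "?N - r" ?N], of i "r - 1"] i False r by (auto simp: I_def)
        moreover have "z < ?N" using i ne by simp
        ultimately show "z \<in> ?T" by simp
      qed
      moreover have "J \<subseteq> ?T" using jn by (auto simp: J_def) 
      moreover have "card ?T < ?N" using ne by simp
      ultimately have "\<exists>i\<in>I. (i + (?N - r)) mod ?N \<in> J"
        using IJ by (intro shift_mod_meet[of I ?N ?T]) (auto simp: I_def)
      then obtain i where "i \<in> I" "(i + (?N - r)) mod ?N \<in> J" by blast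
      then show ?thesis unfolding I_def J_def r(3)
        using two_ends_cycle[OF f(9) f(1-8), of i _ r] r by auto
    qed
  qed
qed

section \<open>Cut vertices on a Hamiltonian path\<close>

lemma has_walk_mono: "has_walk X E u v k \<Longrightarrow> X \<subseteq> Y \<Longrightarrow> has_walk Y E u v k"
  unfolding has_walk_def walk_in_def by blast

lemma has_walk_join:
  assumes "has_walk X E u x k" "has_walk X E y v l" "E x y"
  shows "has_walk X E u v (k + l + 1)"
proof -
  obtain xs ys where "walk_in X E xs" "hd xs = u" "last xs = x" "length xs = Suc k"
    "walk_in X E ys" "hd ys = y" "last ys = v" "length ys = Suc l"
    using assms unfolding has_walk_def by blast
  then have "walk_in X E (xs @ ys)" "hd (xs @ ys) = u" "last (xs @ ys) = v" "length (xs @ ys) = Suc (k + l + 1)"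
    using assms(3) unfolding walk_in_def successively_conv_nth[symmetric] by (auto simp: successively_append_iff)
  then show ?thesis unfolding has_walk_def by blast
qed

lemma connected_join:
  assumes "connected_graph X E" "connected_graph Y E" "x \<in> X" "y \<in> Y" "E x y"
  shows "connected_graph (X \<union> Y) E"
proof -
  have X: "\<exists>k. has_walk (X \<union> Y) E u v k" if "u \<in> X" "v \<in> X" for u v
    using assms(1) that has_walk_mono[of X] unfolding connected_graph_def by blast
  have Y: "\<exists>k. has_walk (X \<union> Y) E u v k" if "u \<in> Y" "v \<in> Y" for u v
    using assms(2) that has_walk_mono[of Y] unfolding connected_graph_def by blast
  have "\<exists>k. has_walk (X \<union> Y) E u v k" if "u \<in> X" "v \<in> Y" for u v
    using X[OF that(1) assms(3)] Y[OF assms(4) that(2)] has_walk_join assms(5) by blast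
  moreover have "\<exists>k. has_walk (X \<union> Y) E v u k" if "u \<in> X" "v \<in> Y" for u v
    using X[OF assms(3) that(1)] Y[OF that(2) assms(4)] has_walk_join sym[OF assms(5)] by blast
  ultimately show ?thesis using X Y assms(3) unfolding connected_graph_def by blast
qed

text \<open>Removing a cut vertex leaves two subpaths, each of them connected; an edge between them
  would reconnect the whole.\<close>

lemma not_two_connected_path:
  assumes p: "pth L" "length L \<ge> 3" and n: "\<not> two_connected (set L) E"
  obtains Xs w Ys where "L = Xs @ w # Ys" "Xs \<noteq> []" "Ys \<noteq> []" "\<forall>x\<in>set Xs. \<forall>y\<in>set Ys. \<not> E x y"
proof -
  have "card (set L) \<ge> 3" using p by (simp add: pth_def distinct_card)
  moreover have "connected_graph (set L) E" using connected_union[OF p(1)] p(2) by fastforce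
  ultimately obtain w where w: "w \<in> set L" "\<not> connected_graph (set L - {w}) E"
    using n unfolding two_connected_def by blast
  obtain Xs Ys where L: "L = Xs @ w # Ys" using w(1) by (meson split_list)
  have pp: "pth Xs" "pth Ys" "set L - {w} = set Xs \<union> set Ys"
    using p(1) unfolding L pth_append pth_Cons by auto
  have len: "length Xs + length Ys \<ge> 2" using p(2) unfolding L by simp
  have n: "\<not> connected_graph (set Xs \<union> set Ys) E" using w(2) unfolding pp(3) .
  have X: "Xs \<noteq> []"
  proof
    assume "Xs = []"
    moreover from this have "Ys \<noteq> []" using len by auto
    ultimately show False using n connected_union[OF pp(2)] by simp
  qed
  moreover have Y: "Ys \<noteq> []"
  proof
    assume "Ys = []"
    then show False using n connected_union[OF pp(1) X] by simp
  qed
  moreover have "\<not> E x y" if "x \<in> set Xs" "y \<in> set Ys" for x y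
    using connected_join[OF connected_union[OF pp(1) X] connected_union[OF pp(2) Y] that] n by blast
  ultimately show thesis using that L by blast
qed

end

section \<open>Cuts at a heavy vertex\<close>

context sgraph
begin

lemma path_closed:
  assumes "pth p" "p \<noteq> []" "hd p \<in> S" "\<And>x y. x \<in> S \<Longrightarrow> E x y \<Longrightarrow> y \<in> set p \<Longrightarrow> y \<in> S"
  shows "set p \<subseteq> S"
  using assms
proof (induction p)
  case (Cons a p)
  have "set p \<subseteq> S" if "p \<noteq> []"
  proof (rule Cons.IH)
    show "hd p \<in> S" using Cons.prems(1,3) Cons.prems(4)[of a "hd p"] that by (simp add: pth_Cons)
    show "pth p" using Cons.prems(1) by (simp add: pth_Cons)
    show "y \<in> S" if "x \<in> S" "E x y" "y \<in> set p" for x y using Cons.prems(4) that by simp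
  qed fact
  then show ?case using Cons.prems(3) by (cases "p = []") auto
qed simp

end

text \<open>Both conditions speak of adjacency inside the configuration only, so they survive vertex
  deletion with membership in \<open>W\<close> unchanged.\<close>

lemma (in wgraph) wgraph_Diff: "wgraph (V - S) E (W - S)"
proof
  show "finite (V - S)" using fin by simp
  show "E x y \<Longrightarrow> E y x" for x y by (rule sym)
  show "\<not> E x x" for x by (rule irr)
  show "W - S \<subseteq> V - S" using WV by blast
  fix c a b d assume *: "c \<in> V - S" "a \<in> V - S" "b \<in> V - S" "d \<in> V - S" "E c a" "E c b" "E c d"
    "a \<noteq> b" "a \<noteq> d" "b \<noteq> d" "\<not> E a b" "\<not> E a d" "\<not> E b d"
  then show "a \<in> W - S \<and> b \<in> W - S \<or> a \<in> W - S \<and> d \<in> W - S \<or> b \<in> W - S \<and> d \<in> W - S"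
    using claw[of c a b d] by blast
next
  fix a b c d e assume *: "a \<in> V - S" "b \<in> V - S" "c \<in> V - S" "d \<in> V - S" "e \<in> V - S"
    "E a b" "E a c" "E b c" "E c d" "E d e" "\<not> E a d" "\<not> E b d" "\<not> E a e" "\<not> E b e" "\<not> E c e"
  then show "d \<in> W - S \<or> a \<in> W - S \<and> b \<in> W - S"
    using z2[of a b c d e] by blast
qed

locale heavy_graph = wgraph +
  assumes tc: "two_connected V E"
    and W_eq: "W = {x \<in> V. 2 * degree V E x \<ge> card V + 1}"
    and np: "\<not> pancyclic V E"
begin

lemma heavy_degree: "x \<in> W \<Longrightarrow> 2 * degree V E x \<ge> card V + 1"
  using W_eq by auto

lemma light_degree: "x \<in> V \<Longrightarrow> x \<notin> W \<Longrightarrow> 2 * degree V E x \<le> card V"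
  using W_eq by auto

lemma degree_le: "N \<subseteq> V \<Longrightarrow> (\<And>y. y \<in> V \<Longrightarrow> E x y \<Longrightarrow> y \<in> N) \<Longrightarrow> degree V E x \<le> card N"
  unfolding degree_def using fin by (intro card_mono) (auto intro: finite_subset)

lemma spanning_cyc: "\<exists>c. cyc c \<and> set c = V"
proof (rule hamiltonian[OF tc])
  fix u v assume "u \<in> W" "v \<in> W"
  then show "card V \<le> degree V E u + degree V E v" using heavy_degree[of u] heavy_degree[of v] by linarith
qed

lemma card_V: "card V \<ge> 4"
proof (rule ccontr)
  assume "\<not> ?thesis"
  moreover obtain c where c: "cyc c" "set c = V" using spanning_cyc by blast
  ultimately have "card V = 3" using spanning_length[OF c] by (auto simp: cyc_def)
  then have "pancyclic V E" using has_lenI[OF c(1)] spanning_length[OF c] by (intro pancyclicI) auto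
  then show False using np by blast
qed

text \<open>Deleting a heavy vertex, and possibly one more vertex, must destroy all Hamiltonian cycles,
  as a heavy vertex sees more than half of any cycle that misses at most one other vertex.\<close>

lemma no_cyc_missing:
  assumes h: "h \<in> W" and c: "cyc c" "set c = V - {h} - S" and S: "card S \<le> 1" "S \<subseteq> V - {h}"
  shows False
proof -
  have fS: "finite S" using S fin finite_subset by blast
  have hV: "h \<in> V" using h WV by blast
  have l: "length c + card S + 1 = card V"
  proof -
    have "length c = card (V - {h} - S)" using c cyc_length by metis
    also have "\<dots> = card V - 1 - card S" using S fS hV fin by (simp add: card_Diff_subset)
    finally show ?thesis using S fS hV fin card_mono[OF _ S(2)] card_V by simp
  qed
  have "degree V E h \<le> card ({x \<in> set c. E h x} \<union> S)"
    using irr c S by (intro degree_le) auto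
  also have "\<dots> \<le> card {x \<in> set c. E h x} + card S" by (rule card_Un_le)
  finally have "2 * card {x \<in> set c. E h x} > length c" using heavy_degree[OF h] l S by linarith
  then have k: "has_len k" if "3 \<le> k" "k \<le> Suc (length c)" for k
    using has_len_missing[OF c(1) hV] c(2) that by blast
  have "has_len k" if "3 \<le> k" "k \<le> card V" for k
  proof (cases "k = card V")
    case True
    then show ?thesis using spanning_cyc has_lenI spanning_length by metis
  qed (use that k l S in auto)
  then show False using np pancyclicI by blast
qed

text \<open>By the condition on \<open>S\<close> a heavy vertex loses no neighbour but
  \<open>h\<close>. Degree sums of heavy pairs remain at least n - 1, so a 2-connected remainder
  would be Hamiltonian, against \<open>no_cyc_missing\<close>.\<close>

lemma not_two_connected_Diff:
  assumes h: "h \<in> W" and S: "card S \<le> 1" "S \<subseteq> V - {h}" and W: "\<And>g s. g \<in> W - {h} - S \<Longrightarrow> s \<in> S \<Longrightarrow> \<not> E g s"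
  shows "\<not> two_connected (V - {h} - S) E"
proof
  assume t: "two_connected (V - {h} - S) E"
  interpret D: wgraph "V - {h} - S" E "W - {h} - S"
    using wgraph.wgraph_Diff[OF wgraph_Diff] .
  have hV: "h \<in> V" using h WV by blast
  have "\<exists>c. D.cyc c \<and> set c = V - {h} - S"
  proof (rule D.hamiltonian[OF t])
    have deg: "degree V E u \<le> Suc (degree (V - {h} - S) E u)" if "u \<in> W - {h} - S" for u
    proof -
      have "{y \<in> V. E u y} \<subseteq> insert h {y \<in> V - {h} - S. E u y}" using W[OF that] by auto
      then have "degree V E u \<le> card (insert h {y \<in> V - {h} - S. E u y})"
        unfolding degree_def using fin by (intro card_mono) auto
      also have "\<dots> \<le> Suc (degree (V - {h} - S) E u)" unfolding degree_def by (rule card_insert_le_m1) auto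
      finally show ?thesis .
    qed
    have "card (V - {h} - S) \<le> card (V - {h})" using fin by (intro card_mono) auto
    then have n: "card (V - {h} - S) \<le> card V - 1" using hV fin by simp
    fix u v assume "u \<in> W - {h} - S" "v \<in> W - {h} - S"
    then show "card (V - {h} - S) \<le> degree (V - {h} - S) E u + degree (V - {h} - S) E v"
      using deg[of u] deg[of v] heavy_degree[of u] heavy_degree[of v] n by auto
  qed
  then obtain c where c: "D.cyc c" "set c = V - {h} - S" by blast
  then have "cyc c" by (auto simp: cyc_def pth_def D.cyc_def D.pth_def)
  then show False using no_cyc_missing[OF h _ c(2) S] by blast
qed

section \<open>Hamiltonian cycles that run through a two-vertex cut\<close>

definition split :: "'a \<Rightarrow> 'a list \<Rightarrow> 'a \<Rightarrow> 'a list \<Rightarrow> bool" where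
  "split h Xs w Ys \<longleftrightarrow> cyc (h # Xs @ w # Ys) \<and> set (h # Xs @ w # Ys) = V \<and> Xs \<noteq> [] \<and> Ys \<noteq> []
     \<and> (\<forall>x\<in>set Xs. \<forall>y\<in>set Ys. \<not> E x y) \<and> h \<in> W"

lemma split_exists:
  assumes h: "h \<in> W" and c: "cyc (h # L)" "set (h # L) = V"
  obtains Xs w Ys where "split h Xs w Ys" "L = Xs @ w # Ys"
proof -
  have "length L \<ge> 3" using spanning_length[OF c] card_V by simp
  moreover have "pth L" "h \<notin> set L" using c(1) by (auto simp: cyc_def pth_Cons)
  moreover have "set L = V - {h}" using c(2) calculation by auto
  moreover have "\<not> two_connected (V - {h}) E" using not_two_connected_Diff[OF h, of "{}"] by simp
  ultimately obtain Xs w Ys where "L = Xs @ w # Ys" "Xs \<noteq> []" "Ys \<noteq> []" "\<forall>x\<in>set Xs. \<forall>y\<in>set Ys. \<not> E x y"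
    using not_two_connected_path[of L] by metis
  then show thesis using that c h unfolding split_def by auto
qed

lemma split_facts:
  assumes "split h Xs w Ys"
  shows "h \<in> V" "w \<in> V" "set Xs \<subseteq> V" "set Ys \<subseteq> V" "h \<noteq> w" "h \<notin> set Xs" "h \<notin> set Ys" "w \<notin> set Xs" "w \<notin> set Ys"
    "set Xs \<inter> set Ys = {}" "pth Xs" "pth Ys" "Xs \<noteq> []" "Ys \<noteq> []" "h \<in> W"
    "card V = length Xs + length Ys + 2" "V = insert h (insert w (set Xs \<union> set Ys))"
  using assms spanning_length[of "h # Xs @ w # Ys"] unfolding split_def cyc_def pth_Cons pth_append by auto

lemma split_edges:
  assumes "split h Xs w Ys"
  shows "E h (hd Xs)" "E (last Xs) w" "E w (hd Ys)" "E (last Ys) h"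
    "E (hd Xs) h" "E w (last Xs)" "E (hd Ys) w" "E h (last Ys)"
    "hd Xs \<in> set Xs" "last Xs \<in> set Xs" "hd Ys \<in> set Ys" "last Ys \<in> set Ys"
proof -
  show e: "E h (hd Xs)" "E (last Xs) w" "E w (hd Ys)" "E (last Ys) h"
    using assms unfolding split_def cyc_def pth_Cons pth_append by auto
  show "E (hd Xs) h" "E w (last Xs)" "E (hd Ys) w" "E h (last Ys)" using e sym by blast+
  show "hd Xs \<in> set Xs" "last Xs \<in> set Xs" "hd Ys \<in> set Ys" "last Ys \<in> set Ys"
    using assms unfolding split_def by auto
qed

lemma split_no_edge:
  assumes "split h Xs w Ys" "x \<in> set Xs" "y \<in> set Ys"
  shows "\<not> E x y" "\<not> E y x"
  using assms sym unfolding split_def by blast+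

lemma split_rev:
  assumes "split h Xs w Ys"
  shows "split h (rev Ys) w (rev Xs)"
proof -
  have "cyc (rev (h # Xs @ w # Ys))" using assms cyc_rev unfolding split_def by blast
  then have "cyc (h # rev Ys @ w # rev Xs)" using cyc_rotate[of "rev Ys @ w # rev Xs" "[h]"] by simp
  then show ?thesis using assms sym unfolding split_def by auto
qed

text \<open>A vertex of an arc sees at most the rest of its arc, \<open>h\<close> and
  \<open>w\<close>; for two vertices on different arcs this adds up to n, one short of two heavy
  degrees.\<close>

lemma split_heavy_one_side:
  assumes s: "split h Xs w Ys" and x: "x \<in> set Xs" "x \<in> W" and y: "y \<in> set Ys" "y \<in> W"
  shows False
proof -
  note f = split_facts[OF s]
  have c: "card (set Xs) = length Xs" "card (set Ys) = length Ys" using f(11,12) by (simp_all add: pth_def distinct_card)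
  have "degree V E x \<le> card (insert h (insert w (set Xs - {x})))"
    using f(1-4,17) split_no_edge[OF s x(1)] irr by (intro degree_le) auto
  also have "\<dots> = length Xs + 1" using f x c by (simp add: card_Diff_singleton)
  finally have 1: "degree V E x \<le> length Xs + 1" .
  have "degree V E y \<le> card (insert h (insert w (set Ys - {y})))"
    using f(1-4,17) split_no_edge[OF s _ y(1)] irr by (intro degree_le) auto
  also have "\<dots> = length Ys + 1" using f y c by (simp add: card_Diff_singleton)
  finally have "degree V E y \<le> length Ys + 1" .
  then show False using 1 heavy_degree[OF x(2)] heavy_degree[OF y(2)] f(16) by linarith
qed

lemma split_hd_light:
  assumes s: "split h Xs w Ys"
  shows "hd Xs \<notin> W"
proof
  assume "hd Xs \<in> W"
  then have "degree V E h + degree V E (hd Xs) \<ge> card V + 1"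
    using heavy_degree[of h] heavy_degree[of "hd Xs"] split_facts[OF s] by linarith
  moreover have "h # Xs @ w # Ys = h # hd Xs # tl Xs @ w # Ys" using s by (simp add: split_def)
  ultimately show False using consecutive_heavy[of h "hd Xs" "tl Xs @ w # Ys"] s np unfolding split_def by metis
qed

lemma split_last_light: "split h Xs w Ys \<Longrightarrow> last Ys \<notin> W"
  using split_hd_light[OF split_rev] by (simp add: hd_rev split_facts(14))

text \<open>The other cycle neighbour of \<open>h\<close> lies across the cut and is not adjacent to
  \<open>g\<close>, as \<open>heavy_around_triangle\<close> demands.\<close>

lemma split_second_heavy:
  assumes s: "split h (x # g # Xs) w Ys" and g: "g \<in> W" "E h g"
  shows False
proof -
  have "degree V E h + degree V E g \<ge> card V + 1"
    using heavy_degree[of h] heavy_degree[of g] g split_facts[OF s] by linarith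
  moreover have "\<not> E g (last (Xs @ w # Ys))" using split_no_edge[OF s, of g "last Ys"] split_facts[OF s] by simp
  ultimately show False
    using heavy_around_triangle[of h x g "Xs @ w # Ys"] s np g unfolding split_def by simp
qed

text \<open>The light vertex \<open>last Ys\<close> across the cut is the third leaf of a claw at
  \<open>h\<close>. One light vertex among \<open>x\<close> and \<open>y\<close> is therefore
  enough.\<close>

lemma split_clique:
  assumes s: "split h Xs w Ys" and x: "x \<in> set Xs" "E h x" "x \<notin> W" and y: "y \<in> set Xs" "E h y" "x \<noteq> y"
  shows "E x y" "E y x"
proof -
  note f = split_facts[OF s] split_edges[OF s] split_last_light[OF s]
  show "E x y"
  proof (rule ccontr)
    assume "\<not> E x y"
    then show False
      using claw[of h x y "last Ys"] f x y split_no_edge[OF s x(1), of "last Ys"] split_no_edge[OF s y(1), of "last Ys"]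
      by blast
  qed
  then show "E y x" by (rule sym)
qed

lemma split_clique':
  assumes s: "split h Xs w Ys" and x: "x \<in> set Ys" "E h x" "x \<notin> W" and y: "y \<in> set Ys" "E h y" "x \<noteq> y"
  shows "E x y" "E y x"
  using split_clique[OF split_rev[OF s]] assms by auto

text \<open>Triangle on one side of the cut, tail on the other: \<open>a\<close> and
  \<open>y\<close> are light, so the Z_2 cannot be induced, and \<open>h z\<close> is the only edge
  left to spoil it.\<close>

lemma split_z2:
  assumes s: "split h Xs w Ys" and ab: "a \<in> set Xs" "b \<in> set Xs" "E h a" "E h b" "E a b" "a \<notin> W"
    and y: "y \<in> set Ys" "E h y" "y \<notin> W" and z: "z \<in> set Ys" "E y z"
  shows "E h z"
proof (rule ccontr)
  assume "\<not> E h z"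
  then show False
    using z2[of a b h y z] ab y z split_facts[OF s] split_no_edge[OF s] sym by blast
qed

lemma split_z2':
  assumes s: "split h Xs w Ys" and ab: "a \<in> set Ys" "b \<in> set Ys" "E h a" "E h b" "E a b" "a \<notin> W"
    and y: "y \<in> set Xs" "E h y" "y \<notin> W" and z: "z \<in> set Xs" "E y z"
  shows "E h z"
  using split_z2[OF split_rev[OF s], of a b y z] assms by simp

end

section \<open>Cuts with several neighbours on both sides\<close>

text \<open>Besides \<open>hd Xs\<close> the vertex \<open>h\<close> has a second neighbour
  \<open>x2\<close> on this arc. Since \<open>hd Xs\<close> is light, the three form a triangle,
  ready for \<open>split_z2\<close>.\<close>

locale big_side = heavy_graph +
  fixes h w :: 'a and Xs Ys :: "'a list" and x2 :: 'a
  assumes s: "split h Xs w Ys" and x2: "x2 \<in> set Xs" "x2 \<noteq> hd Xs" "E h x2"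
begin

abbreviation "t \<equiv> hd Xs"

lemmas sf = split_facts[OF s]
lemmas se = split_edges[OF s]

lemma t: "t \<in> set Xs" "E h t" "E t h" "t \<notin> W" "t \<in> V"
  using se sf split_hd_light[OF s] by auto

lemma t_clique: "x \<in> set Xs \<Longrightarrow> E h x \<Longrightarrow> x \<noteq> t \<Longrightarrow> E t x \<and> E x t"
  using split_clique[OF s t(1,2,4)] by auto

end

locale wide_split = big_side +
  fixes y2 :: 'a
  assumes Ys_light: "set Ys \<inter> W = {}"
    and y2: "y2 \<in> set Ys" "y2 \<noteq> last Ys" "E h y2"
begin

text \<open>Adjacency to \<open>h\<close> spreads along the light arc from \<open>last Ys\<close>,
  by \<open>split_z2\<close> with the triangle \<open>t, x2, h\<close>.\<close>

lemma Ys_adj: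
  assumes "y \<in> set Ys"
  shows "E h y"
proof -
  have "set (rev Ys) \<subseteq> {y \<in> set Ys. E h y}"
  proof (rule path_closed)
    show "pth (rev Ys)" using sf(12) pth_rev by simp
    show "rev Ys \<noteq> []" using sf(14) by simp
    show "hd (rev Ys) \<in> {y \<in> set Ys. E h y}" using se(8,12) by (simp add: hd_rev)
    fix x y assume "x \<in> {y \<in> set Ys. E h y}" "E x y" "y \<in> set (rev Ys)"
    then show "y \<in> {y \<in> set Ys. E h y}"
      using split_z2[OF s t(1) x2(1) t(2) x2(3) _ t(4), of x y] t_clique[OF x2(1,3,2)] Ys_light by auto
  qed
  then show ?thesis using assms by auto
qed

lemma Ys_clique: "x \<in> set Ys \<Longrightarrow> y \<in> set Ys \<Longrightarrow> x \<noteq> y \<Longrightarrow> E x y"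
  using split_clique'[OF s] Ys_adj Ys_light by blast

text \<open>The same propagation in the other direction, with the triangle
  \<open>y2, last Ys, h\<close>.\<close>

lemma light_nbr:
  assumes "x \<in> set Xs" "E h x" "x \<notin> W" "r \<in> set Xs" "E x r"
  shows "E h r"
  using split_z2'[OF s y2(1) se(12) y2(3) se(8) _ _ assms(1-5)] Ys_clique[OF y2(1) se(12) y2(2)] y2(1) Ys_light
  by auto

text \<open>A heavy vertex of \<^term>\<open>set Xs\<close> outside the neighbourhood of \<^term>\<open>h\<close> has two heavy common neighbours
  with \<^term>\<open>h\<close>. The cuts through these cut off two pieces whose only other attachment is that vertex,
  which makes it the centre of a claw.\<close>

lemma cut_piece:
  assumes r: "r \<in> set Xs" "\<not> E h r" "r \<in> W"
    and g: "g \<in> set Xs" "E h g" "E g r" "g \<in> W" and g': "g' \<in> set Xs" "E h g'" "E g' r" "g' \<in> W" "g \<noteq> g'"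
    and z: "z \<in> V" "E h z" "E z r" "z \<noteq> g" "z \<noteq> g'"
    and V: "V = insert g (insert w' (P \<union> Q))"
    and disj: "g \<noteq> w'" "g \<notin> P" "g \<notin> Q" "w' \<notin> P" "w' \<notin> Q" "P \<inter> Q = {}"
    and PQ: "\<And>p q. p \<in> P \<Longrightarrow> q \<in> Q \<Longrightarrow> \<not> E p q \<and> \<not> E q p"
    and one: "\<And>p q. p \<in> P \<Longrightarrow> q \<in> Q \<Longrightarrow> p \<in> W \<Longrightarrow> q \<in> W \<Longrightarrow> False"
    and nb: "\<exists>p\<in>P. E g p" "\<exists>q\<in>Q. E g q" "\<exists>q\<in>Q. E w' q" and hQ: "h \<notin> Q"
  shows "w' = r \<and> h \<in> P \<and> g' \<in> P"
proof -
  have hr: "h \<noteq> r" "h \<noteq> g" "h \<noteq> g'" "r \<noteq> g" "r \<noteq> g'" "t \<noteq> r" "t \<noteq> g" "t \<noteq> g'"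
    using r g g' t irr sf(6) by auto
  have tr: "\<not> E t r" "\<not> E r t" using light_nbr[OF t(1,2,4) r(1)] r(2) sym by blast+
  have tg: "E t g" "E g t" "E t g'" "E g' t" using t_clique g g' hr by auto
  have inV: "h \<in> V" "r \<in> V" "g \<in> V" "g' \<in> V" "t \<in> V" using sf r g g' t by auto
  have sy: "E g h" "E g' h" "E r g" "E r g'" "E z h" "E r z" using g g' z sym by blast+
  \<comment> \<open>For \<open>w' = t\<close> all neighbours of \<open>h\<close> except
    \<open>g\<close> and \<open>t\<close> lie in \<open>P\<close>. A neighbour of \<open>t\<close>
    in \<open>Q\<close> then avoids \<open>h\<close>, hence both arcs, and also \<open>w\<close>,
    whose neighbour \<open>hd Ys\<close> is in \<open>P\<close>.\<close>
  have w't: "w' \<noteq> t"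
  proof
    assume w': "w' = t"
    have hP: "h \<in> P" using V hQ inV w' hr t(1) sf(6) by auto
    have nP: "x \<in> P" if "E h x" "x \<in> V" "x \<noteq> g" "x \<noteq> t" for x using that V hP PQ w' by blast
    have "g' \<in> P" using nP g' hr inV by auto
    obtain q where q: "q \<in> Q" "E t q" using nb(3) w' by blast
    have "q \<noteq> h" using q hQ by auto
    have "\<not> E h q" using q hP PQ by blast
    have "q \<notin> set Xs" using light_nbr[OF t(1,2,4) _ q(2)] \<open>\<not> E h q\<close> by blast
    moreover have "q \<notin> set Ys" using Ys_adj \<open>\<not> E h q\<close> by blast
    moreover have "q \<noteq> w"
    proof
      assume "q = w"
      have "hd Ys \<noteq> g" "hd Ys \<noteq> t" "hd Ys \<in> V" using se(11) sf(4,10) g(1) t(1) by auto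
      then have "hd Ys \<in> P" using nP[of "hd Ys"] Ys_adj[OF se(11)] by simp
      then show False using PQ[of "hd Ys" q] q(1) \<open>q = w\<close> se(7) by simp
    qed
    ultimately show False using \<open>q \<noteq> h\<close> sf(17) q(1) V by auto
  qed
  have w'r: "w' = r"
  proof (rule ccontr)
    assume w'r: "w' \<noteq> r"
    have tPQ: "t \<in> P \<or> t \<in> Q" "r \<in> P \<or> r \<in> Q" using V inV w't w'r hr by auto
    \<comment> \<open>The non-adjacent \<open>t\<close> and \<open>r\<close> both see
      \<open>g\<close>. On the same side they give a claw with a vertex of the other side; on
      different sides \<open>g'\<close> must be \<open>w'\<close>, and then \<open>z\<close> or the
      edge \<open>h t\<close> crosses the cut.\<close>
    consider (1) "t \<in> P" "r \<in> P" | (2) "t \<in> Q" "r \<in> Q" | (3) "t \<in> P" "r \<in> Q" | (4) "t \<in> Q" "r \<in> P"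
      using tPQ by blast
    then show False
    proof cases
      case 1
      obtain y where y: "y \<in> Q" "E g y" using nb by blast
      then have "y \<noteq> t" "y \<noteq> r" "\<not> E t y" "\<not> E y r" "y \<in> V" using 1 disj PQ V by auto
      then show False using claw[of g t y r] inV g tg y tr t(4) one[OF 1(2) y(1)] r(3) hr by auto
    next
      case 2
      obtain y where y: "y \<in> P" "E g y" using nb by blast
      then have "y \<noteq> t" "y \<noteq> r" "\<not> E t y" "\<not> E y r" "y \<in> V" using 2 disj PQ V by auto
      then show False using claw[of g t y r] inV g tg y tr t(4) one[OF y(1) 2(2)] r(3) hr by auto
    next
      case 3
      then have "g' = w'" using PQ tg g' V inV by blast
      then have "h \<in> P" using V hQ inV hr by auto
      then show False using 3 PQ z sy V \<open>g' = w'\<close> by blast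
    next
      case 4
      then have "g' = w'" using PQ tg g' V inV sy by blast
      then have "h \<in> P" using V hQ inV hr by auto
      then show False using 4 PQ t by blast
    qed
  qed
  have "h \<in> P" using V hQ inV hr w'r by auto
  moreover have "g' \<in> P" using calculation PQ g' V inV w'r hr by blast
  ultimately show ?thesis using w'r by blast
qed

text \<open>A Hamiltonian cycle split at \<open>g\<close> supplies the cut, reversed if necessary so
  that \<open>h\<close> is not in \<open>Q\<close>. The piece is light because the other one
  contains the heavy \<open>h\<close>.\<close>

lemma cut_piece_exists:
  assumes r: "r \<in> set Xs" "\<not> E h r" "r \<in> W"
    and g: "g \<in> set Xs" "E h g" "E g r" "g \<in> W" and g': "g' \<in> set Xs" "E h g'" "E g' r" "g' \<in> W" "g \<noteq> g'"
    and z: "z \<in> V" "E h z" "E z r" "z \<noteq> g" "z \<noteq> g'"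
  shows "\<exists>Q q. q \<in> Q \<and> E r q \<and> Q \<subseteq> V \<and> h \<notin> Q \<and> g' \<notin> Q \<and> g \<notin> Q \<and> r \<notin> Q \<and> Q \<inter> W = {}
     \<and> (\<forall>u\<in>Q. \<not> E h u \<and> (\<forall>v\<in>V. E u v \<longrightarrow> v \<in> Q \<or> v = g \<or> v = r))"
proof -
  obtain C where C: "cyc C" "set C = V" using spanning_cyc by blast
  have "g \<in> set C" using C(2) g(4) WV by blast
  then obtain L where "cyc (g # L)" "set (g # L) = set C" using cyc_at[OF C(1)] by blast
  then have L: "cyc (g # L)" "set (g # L) = V" using C(2) by simp_all
  obtain A w' B where sp: "split g A w' B" and "L = A @ w' # B" by (rule split_exists[OF g(4) L])
  have *: "w' = r \<and> h \<in> set P \<and> g' \<in> set P" if sp: "split g P w' Q" "h \<notin> set Q" for P Q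
  proof -
    note f = split_facts[OF sp(1)] and e = split_edges[OF sp(1)] and n = split_no_edge[OF sp(1)]
    show ?thesis
      by (rule cut_piece[OF r g g' z f(17) f(5,6,7,8,9,10) _ _ _ _ _ sp(2)])
        (use n e split_heavy_one_side[OF sp(1)] in blast)+
  qed
  have "\<exists>P Q. split g P w' Q \<and> h \<notin> set Q"
  proof (cases "h \<in> set B")
    case True
    then have "h \<notin> set (rev A)" using split_facts(10)[OF sp] by auto
    then show ?thesis using split_rev[OF sp] by blast
  qed (use sp in blast)
  then obtain P Q where sp: "split g P w' Q" "h \<notin> set Q" by blast
  note f = split_facts[OF sp(1)] and e = split_edges[OF sp(1)] and n = split_no_edge[OF sp(1)]
  have k: "w' = r" "h \<in> set P" "g' \<in> set P" using *[OF sp] by auto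
  have "set Q \<inter> W = {}" using split_heavy_one_side[OF sp(1) k(2) sf(15)] by blast
  moreover have "\<forall>u\<in>set Q. \<not> E h u \<and> (\<forall>v\<in>V. E u v \<longrightarrow> v \<in> set Q \<or> v = g \<or> v = r)"
    using n k f(17) by blast
  moreover have "hd Q \<in> set Q" "E r (hd Q)" "set Q \<subseteq> V" "g' \<notin> set Q" "g \<notin> set Q" "r \<notin> set Q"
    using e f k by auto
  ultimately show ?thesis using sp(2) by blast
qed

text \<open>The heavy non-adjacent \<open>h\<close> and \<open>r\<close> distribute degree sum n + 1
  over n - 2 vertices, so they share at least three neighbours. Two of these differ from
  \<open>w\<close> and are heavy by \<open>light_nbr\<close>; a third is the last leaf of the final
  claw at \<open>r\<close>.\<close>

lemma no_heavy_outside: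
  assumes r: "r \<in> set Xs" "\<not> E h r"
  shows "r \<notin> W"
proof
  assume rW: "r \<in> W"
  have rV: "r \<in> V" "r \<noteq> h" using r sf by auto
  define CN where "CN = {y \<in> V. E h y} \<inter> {y \<in> V. E r y}"
  have fCN: "finite CN" using fin by (simp add: CN_def)
  have "card CN + card ({y \<in> V. E h y} \<union> {y \<in> V. E r y}) = degree V E h + degree V E r"
    unfolding CN_def degree_def using fin by (subst card_Un_Int) auto
  moreover have "card ({y \<in> V. E h y} \<union> {y \<in> V. E r y}) \<le> card (V - {h, r})"
    using fin irr r sym by (intro card_mono) auto
  moreover have "card (V - {h, r}) = card V - 2" using rV sf(1) fin by (simp add: card_Diff_subset)
  ultimately have CN3: "card CN \<ge> 3" using heavy_degree[OF sf(15)] heavy_degree[OF rW] card_V by linarith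
  have CNs: "x \<in> set Xs \<or> x = w" if "x \<in> CN" for x
    using that sf(17) r split_no_edge[OF s r(1)] irr sym unfolding CN_def by blast
  have "card (CN - {w}) \<ge> 2" using CN3 fCN by (auto simp: card_Diff_singleton_if)
  then obtain T where "T \<subseteq> CN - {w}" "card T = 2" by (metis obtain_subset_with_card_n)
  then obtain g1 g2 where g12: "g1 \<in> CN" "g2 \<in> CN" "g1 \<noteq> w" "g2 \<noteq> w" "g1 \<noteq> g2" by (auto simp: card_2_iff)
  have "card (CN - {g1, g2}) \<ge> 1" using CN3 fCN g12 by (simp add: card_Diff_subset)
  then obtain z where z: "z \<in> CN" "z \<noteq> g1" "z \<noteq> g2" by (metis DiffE card.empty ex_in_conv insertCI not_one_le_zero)
  have m: "g1 \<in> set Xs" "g2 \<in> set Xs" "E h g1" "E h g2" "E g1 r" "E g2 r" "z \<in> V" "E h z" "E z r"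
    using g12 z CNs sym unfolding CN_def by auto
  have gW: "g1 \<in> W" "g2 \<in> W" using light_nbr[OF _ _ _ r(1)] m r(2) by blast+
  obtain Q1 q1 where Q1: "q1 \<in> Q1" "E r q1" "Q1 \<subseteq> V" "h \<notin> Q1" "g2 \<notin> Q1" "g1 \<notin> Q1" "r \<notin> Q1" "Q1 \<inter> W = {}"
    "\<forall>u\<in>Q1. \<not> E h u \<and> (\<forall>v\<in>V. E u v \<longrightarrow> v \<in> Q1 \<or> v = g1 \<or> v = r)"
    using cut_piece_exists[OF r rW m(1,3,5) gW(1) m(2,4,6) gW(2) g12(5) m(7-9) z(2,3)] by blast
  obtain Q2 q2 where Q2: "q2 \<in> Q2" "E r q2" "Q2 \<subseteq> V" "h \<notin> Q2" "g1 \<notin> Q2" "g2 \<notin> Q2" "r \<notin> Q2" "Q2 \<inter> W = {}"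
    "\<forall>u\<in>Q2. \<not> E h u \<and> (\<forall>v\<in>V. E u v \<longrightarrow> v \<in> Q2 \<or> v = g2 \<or> v = r)"
    using cut_piece_exists[OF r rW m(2,4,6) gW(2) m(1,3,5) gW(1) g12(5)[symmetric] m(7-9) z(3,2)] by blast
  \<comment> \<open>A vertex in both pieces could reach \<open>h\<close> only through
    \<open>r\<close>, against 2-connectedness.\<close>
  have disj: "Q1 \<inter> Q2 = {}"
  proof (rule ccontr)
    assume "Q1 \<inter> Q2 \<noteq> {}"
    then obtain q where q: "q \<in> Q1" "q \<in> Q2" by blast
    obtain p where p: "p \<noteq> []" "hd p = q" "pth p" "r \<notin> set p" "last p \<in> {h}"
      using two_connected_path_hit[OF tc rV(1), of q "{h}" h thesis] q Q1 sf(1) rV by auto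
    have "set p \<subseteq> Q1 \<inter> Q2"
    proof (rule path_closed[OF p(3,1)])
      show "hd p \<in> Q1 \<inter> Q2" using p q by simp
      fix x y assume *: "x \<in> Q1 \<inter> Q2" "E x y" "y \<in> set p"
      then have "y \<in> V" "y \<noteq> r" using p by (auto simp: pth_def)
      then show "y \<in> Q1 \<inter> Q2" using * Q1(5,6,9) Q2(5,6,9) g12(5) by blast
    qed
    then show False using p Q1(4) last_in_set[OF p(1)] by auto
  qed
  have "q1 \<in> V" "q2 \<in> V" "q1 \<noteq> q2" "z \<noteq> q1" "z \<noteq> q2" using Q1 Q2 disj m(8) by auto
  moreover have "\<not> E q1 q2" using Q1(1,9) Q2(1,5,7) disj \<open>q2 \<in> V\<close> by blast
  moreover have "z \<noteq> r" using m(9) irr by auto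
  then have "\<not> E q1 z" "\<not> E q2 z" using Q1(1,9) Q2(1,9) m(7,8) z by blast+
  ultimately show False
    using claw[of r q1 q2 z] rV(1) Q1(1,2,8) Q2(1,2,8) m sym[OF m(9)] by blast
qed

text \<open>If neither of two consecutive vertices sees \<open>h\<close>, the witness
  \<open>g\<close> passes from one to the next: otherwise the triangle \<open>t, h, g\<close> with
  these two as tail would make the first one heavy, against \<open>no_heavy_outside\<close>.\<close>

lemma adj_h_or_earlier:
  assumes "Suc i < length Xs"
  shows "E h (Xs ! Suc i) \<or> (\<exists>g\<in>set (take (Suc i) Xs). g \<noteq> t \<and> E h g \<and> E g (Xs ! Suc i))"
  using assms
proof (induction i)
  case 0
  have "E (Xs ! 0) (Xs ! 1)" using sf(11) 0 by (simp add: pth_def successively_nth)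
  then have "E t (Xs ! 1)" using sf(13) by (simp add: hd_conv_nth)
  then show ?case using light_nbr[OF t(1,2,4)] 0 by simp
next
  case (Suc i)
  let ?x = "Xs ! Suc i" and ?y = "Xs ! Suc (Suc i)"
  have e: "E ?x ?y" using sf(11) Suc.prems by (simp add: pth_def successively_nth)
  have m: "?x \<in> set Xs" "?y \<in> set Xs" using Suc.prems by auto
  have tk: "take (Suc (Suc i)) Xs = take (Suc i) Xs @ [?x]" using Suc.prems by (simp add: take_Suc_conv_app_nth)
  show ?case
  proof (cases "E h ?x \<or> E h ?y")
    case True
    have "?x \<noteq> t" using sf(11) Suc.prems sf(13) by (simp add: hd_conv_nth pth_def nth_eq_iff_index_eq)
    then show ?thesis using True e tk by auto
  next
    case False
    then obtain g where g: "g \<in> set (take (Suc i) Xs)" "g \<noteq> t" "E h g" "E g ?x" using Suc by auto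
    have gX: "g \<in> set Xs" using g(1) by (rule in_set_takeD)
    have "E g ?y"
    proof (rule ccontr)
      assume "\<not> E g ?y"
      moreover have "\<not> E t ?x" "\<not> E t ?y" using light_nbr[OF t(1,2,4)] m False by blast+
      ultimately have "?x \<in> W"
        using z2[of t h g ?x ?y] t sf m gX g e False t_clique[OF gX g(3,2)] by blast
      then show False using no_heavy_outside m False by blast
    qed
    then show ?thesis using g tk by auto
  qed
qed

text \<open>The part of \<open>Xs\<close> before position \<open>i\<close> is skipped except for
  \<open>u\<close>, and any vertex of \<open>Ys\<close> can close the cycle, since all of them see
  \<open>h\<close>.\<close>

lemma shortcut_cycle:
  assumes u: "u \<in> set (take i Xs)" "E h u" "E u (Xs ! i)" and i: "i < length Xs" and j: "1 \<le> j" "j \<le> length Ys"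
  shows "has_len (3 + (length Xs - i) + j)"
proof -
  let ?D = "drop i Xs" and ?T = "take j Ys"
  have D: "?D \<noteq> []" "hd ?D = Xs ! i" "last ?D = last Xs" "set ?D \<subseteq> set Xs" "pth ?D"
    using i sf(11) by (auto simp: hd_drop_conv_nth pth_drop dest: in_set_dropD)
  have T: "?T \<noteq> []" "hd ?T = hd Ys" "set ?T \<subseteq> set Ys" "pth ?T"
    using j sf(12,14) by (auto simp: pth_take dest: in_set_takeD)
  have "u \<in> set Xs" using u(1) by (rule in_set_takeD)
  have "u \<notin> set ?D" using u(1) sf(11) set_take_disj_set_drop_if_distinct[of Xs i i] by (auto simp: pth_def)
  have "last ?T \<in> set Ys" using last_in_set[OF T(1)] T(3) by blast
  then have "E (last ?T) h" using Ys_adj sym by blast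
  have "pth (w # ?T)" using T se(3) sf(1-15) by (auto simp: pth_Cons)
  then have "pth (?D @ w # ?T)" using D T se(2) sf(1-15) by (auto simp: pth_append)
  then have "pth (h # u # ?D @ w # ?T)"
    using u D T sf(1-15) \<open>u \<in> set Xs\<close> \<open>u \<notin> set ?D\<close> by (auto simp: pth_Cons)
  then have "cyc (h # u # ?D @ w # ?T)" using \<open>E (last ?T) h\<close> T(1) j by (auto simp: cyc_def)
  then show ?thesis by (rule has_lenI) (use j i in auto)
qed

lemma contradiction: False
proof -
  let ?m = "length Xs" and ?q = "length Ys"
  have m2: "?m \<ge> 2" using x2 t by (cases Xs rule: remdups_adj.cases) auto
  have q2: "?q \<ge> 2" using y2 by (cases Ys rule: remdups_adj.cases) auto
  \<comment> \<open>The two parameters cover every length from 5 to n; 3 and 4 need cycles of their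
    own.\<close>
  have short: "has_len (3 + (?m - i) + j)" if "1 \<le> i" "i < ?m" "1 \<le> j" "j \<le> ?q" for i j
  proof -
    obtain i' where i': "i = Suc i'" using \<open>1 \<le> i\<close> by (cases i) auto
    have "\<exists>u\<in>set (take i Xs). E h u \<and> E u (Xs ! i)"
    proof (cases "E h (Xs ! i)")
      case True
      have "Xs ! i \<noteq> t" using sf(11,13) that by (simp add: hd_conv_nth pth_def nth_eq_iff_index_eq)
      then have "E t (Xs ! i)" using t_clique True that by simp
      moreover have "t \<in> set (take i Xs)" using i' sf(13) by (cases Xs) auto
      ultimately show ?thesis using t by blast
    next
      case False
      then show ?thesis using adj_h_or_earlier[of i'] that unfolding i' by blast
    qed
    then show ?thesis using shortcut_cycle that by blast
  qed
  have lY: "E (hd Ys) (last Ys)" "E (last Ys) (hd Ys)" "hd Ys \<noteq> last Ys"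
  proof -
    show "hd Ys \<noteq> last Ys" using q2 sf(12) by (cases Ys rule: remdups_adj.cases) (auto simp: pth_def)
    then show "E (hd Ys) (last Ys)" "E (last Ys) (hd Ys)" using Ys_clique se(11,12) by auto
  qed
  have hY: "E h (hd Ys)" "E (hd Ys) h" "hd Ys \<in> V" "last Ys \<in> V" using Ys_adj se sf(4) sym by blast+
  have "has_len 4"
  proof -
    let ?x = "last Xs"
    have sm: "Suc (?m - 2) < ?m" using m2 by simp
    have "Suc (?m - 2) = ?m - 1" using m2 by simp
    then have xl: "?x = Xs ! Suc (?m - 2)" using last_conv_nth[OF sf(13)] by simp
    have xV: "?x \<in> V" "?x \<noteq> h" "?x \<noteq> hd Ys" using se(10,11) sf(3,6,10) by (metis disjoint_iff subsetD)+
    show ?thesis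
    proof (cases "E h ?x")
      case True
      then have "cyc [h, ?x, w, hd Ys]" using se hY sf(1-15) xV by (auto simp: cyc_def pth_def)
      then show ?thesis by (rule has_lenI) simp
    next
      case False
      then obtain g where g: "g \<in> set Xs" "g \<noteq> t" "E h g" "E g ?x"
        using adj_h_or_earlier[of "?m - 2"] sm unfolding xl[symmetric] by (meson in_set_takeD)
      have gW: "g \<in> W" using light_nbr[OF g(1,3) _ se(10) g(4)] False by blast
      have tg: "E t g" "E g t" using t_clique g by auto
      have gV: "g \<in> V" "g \<noteq> h" "g \<noteq> w" "g \<noteq> hd Ys" using g sf(3,6,8,10) se(11) by (metis disjoint_iff subsetD)+
      show ?thesis
      proof (cases "\<exists>a\<in>V. a \<noteq> t \<and> E h a \<and> E g a")
        case True
        then obtain a where "a \<in> V" "a \<noteq> t" "E h a" "E g a" by blast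
        then have "cyc [h, t, g, a]" using t tg gV sf(1-15) g irr sym by (auto simp: cyc_def pth_def)
        then show ?thesis by (rule has_lenI) simp
      next
        case no: False
        \<comment> \<open>With at most one common neighbour, the neighbourhoods of the heavy
          \<open>h\<close> and \<open>g\<close> cover all of \<open>V\<close>, so one of the two
          sees \<open>w\<close>.\<close>
        let ?H = "{y \<in> V. E h y}" and ?G = "{y \<in> V. E g y}"
        have "card (?H \<inter> ?G) \<le> card {t}" using no by (intro card_mono) auto
        moreover have "card (?H \<union> ?G) + card (?H \<inter> ?G) = degree V E h + degree V E g"
          unfolding degree_def using fin by (subst card_Un_Int) auto
        ultimately have "card (?H \<union> ?G) \<ge> card V"
          using heavy_degree[OF gW] heavy_degree[OF sf(15)] by simp
        then have "?H \<union> ?G = V" using fin by (intro card_seteq) auto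
        then have "E h w \<or> E g w" using sf(2) by blast
        then show ?thesis
        proof
          assume "E h w"
          then have "cyc [h, w, hd Ys, last Ys]" using se hY lY sf(1-15) by (auto simp: cyc_def pth_def)
          then show ?thesis by (rule has_lenI) simp
        next
          assume "E g w"
          then have "cyc [h, g, w, hd Ys]" using se hY sf(1-15) g gV by (auto simp: cyc_def pth_def)
          then show ?thesis by (rule has_lenI) simp
        qed
      qed
    qed
  qed
  moreover have "has_len 3"
  proof -
    have "cyc [h, hd Ys, last Ys]" using hY lY se sf(1-15) by (auto simp: cyc_def pth_def)
    then show ?thesis by (rule has_lenI) simp
  qed
  moreover have "has_len k" if "5 \<le> k" "k \<le> card V" for k
  proof (cases "k \<le> 4 + ?q")
    case True
    then show ?thesis using short[of "?m - 1" "k - 4"] m2 that by simp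
  next
    case False
    then show ?thesis using short[of "3 + ?m + ?q - k" ?q] m2 q2 that sf(16) by simp
  qed
  ultimately have "has_len k" if "3 \<le> k" "k \<le> card V" for k
    using that by (cases "k = 3"; cases "k = 4") auto
  then show False using np pancyclicI by blast
qed

end

section \<open>Cuts with a single vertex on one side\<close>

context heavy_graph
begin

text \<open>At least one arc contains no heavy vertex; reversing the cycle makes it the arc
  \<open>Ys\<close>.\<close>

lemma wide_contradiction:
  assumes s: "split h Xs w Ys" and x2: "x2 \<in> set Xs" "x2 \<noteq> hd Xs" "E h x2"
    and y2: "y2 \<in> set Ys" "y2 \<noteq> last Ys" "E h y2"
  shows False
proof (cases "set Ys \<inter> W = {}")
  case True
  interpret wide_split V E W h w Xs Ys x2 y2
    by unfold_locales (fact s x2 True y2)+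
  show False by (rule contradiction)
next
  case False
  then have "set Xs \<inter> W = {}" using split_heavy_one_side[OF s] by blast
  then interpret wide_split V E W h w "rev Ys" "rev Xs" y2 x2
    using split_rev[OF s] x2 y2 split_facts(13,14)[OF s] by unfold_locales (auto simp: hd_rev last_rev)
  show False by (rule contradiction)
qed

lemma split_tiny:
  assumes s: "split h Xs w [y]" and hw: "E h w" and n: "card V \<le> 5"
  shows False
proof -
  note f = split_facts[OF s] and e = split_edges[OF s]
  have c: "cyc (h # Xs @ [w, y])" "set (h # Xs @ [w, y]) = V" using s by (auto simp: split_def)
  have "pth (h # Xs @ [w])" using c(1) f(1-15) e by (auto simp: cyc_def pth_Cons pth_append)
  then have "cyc (h # Xs @ [w])" using hw f(13) sym by (cases Xs) (auto simp: cyc_def)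
  then have "has_len (card V - 1)" using f(16) by (intro has_lenI) auto
  moreover have "cyc [h, w, y]" using f(1-10) e hw by (auto simp: cyc_def pth_def)
  then have "has_len 3" by (rule has_lenI) simp
  moreover have "has_len (card V)" using has_lenI[OF c(1)] spanning_length[OF c] by simp
  moreover have "k = 3 \<or> k = card V - 1 \<or> k = card V" if "3 \<le> k" "k \<le> card V" for k
    using that n by linarith
  ultimately show False using np by (metis pancyclicI)
qed

end

locale narrow_split = big_side +
  fixes y :: 'a
  assumes Ys: "Ys = [y]"
begin

lemma y: "y \<in> V" "y \<notin> W" "E h y" "E y h" "E w y" "E y w" "y \<noteq> h" "y \<noteq> w" "y \<notin> set Xs"
  using sf(1-14) se split_last_light[OF s] unfolding Ys by auto

lemma y_not_adj: "x \<in> set Xs \<Longrightarrow> \<not> E x y" "x \<in> set Xs \<Longrightarrow> \<not> E y x"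
  using split_no_edge[OF s] Ys by auto

lemma split_single: "split h Xs w [y]"
  using s Ys by simp

lemma V_eq: "V = insert h (insert w (insert y (set Xs)))"
  using sf(17) Ys by auto

lemma n_eq: "card V = length Xs + 3"
  using sf(16) Ys by simp

text \<open>Without \<open>h w\<close> a light neighbour of \<open>h\<close> on \<open>Xs\<close>
  has its degree used up by \<open>h\<close> and the clique \<open>X\<close>. So the successor
  \<open>x1\<close> of \<open>t\<close> is in \<open>X\<close>; if light it gives a Z_2 with tail
  \<open>y, w\<close>, if heavy it contradicts \<open>split_second_heavy\<close>.\<close>

lemma h_adj_w: "E h w"
proof (rule ccontr)
  assume h_adj_w: "\<not> E h w"
  define X where "X = {x \<in> set Xs. E h x}"
  have fX: "finite X" "X \<subseteq> V" using sf(3) by (auto simp: X_def)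
  have "degree V E h \<le> card (insert y X)"
    using fX y(1) h_adj_w V_eq irr by (intro degree_le) (auto simp: X_def)
  also have "\<dots> \<le> Suc (card X)" using fX by (simp add: card_insert_if)
  finally have cX: "2 * card X + 1 \<ge> card V" using heavy_degree[OF sf(15)] by simp
  have nbr: "v = h \<or> v \<in> X" if x: "x \<in> X" "x \<notin> W" "v \<in> V" "E x v" for x v
  proof -
    have xX: "x \<in> set Xs" "E h x" using x by (auto simp: X_def)
    have sub: "insert h (X - {x}) \<subseteq> {v \<in> V. E x v}"
      using split_clique(1)[OF s xX x(2)] fX sf(1) xX sym by (auto simp: X_def)
    have "card (insert h (X - {x})) = card X"
    proof -
      have "h \<notin> X" using sf(6) by (simp add: X_def)
      moreover have "card X > 0" using fX(1) x(1) card_gt_0_iff by blast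
      ultimately show ?thesis using fX(1) x(1) by simp
    qed
    moreover have "card {v \<in> V. E x v} \<le> card X"
    proof -
      have "2 * degree V E x \<le> card V" using light_degree[of x] x(1,2) fX(2) by blast
      then show ?thesis using cX unfolding degree_def by linarith
    qed
    ultimately have "insert h (X - {x}) = {v \<in> V. E x v}" using sub fin by (intro card_seteq) auto
    then show ?thesis using x by blast
  qed
  have tX: "t \<in> X" using t by (simp add: X_def)
  obtain x1 R where Xs: "Xs = t # x1 # R" using x2 t(1) by (cases Xs rule: remdups_adj.cases) auto
  have x1: "E t x1" "x1 \<in> set Xs" "x1 \<in> V" "x1 \<noteq> h"
  proof -
    show "x1 \<in> set Xs" using arg_cong[OF Xs, of set] by auto
    then show "x1 \<in> V" "x1 \<noteq> h" using sf(3,6) by auto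
    have "pth (t # x1 # R)" using sf(11) arg_cong[OF Xs, of pth] by simp
    then show "E t x1" by (simp add: pth_Cons)
  qed
  then have x1X: "x1 \<in> X" using nbr[OF tX t(4)] by blast
  have "x1 \<in> W"
  proof (rule ccontr)
    assume "x1 \<notin> W"
    have w: "\<not> E t w" "\<not> E x1 w"
      using nbr[OF tX t(4) sf(2)] nbr[OF x1X \<open>x1 \<notin> W\<close> sf(2)] sf(5,8) by (auto simp: X_def)
    have "E h x1" using x1X by (simp add: X_def)
    then show False
      using z2[of t x1 h y w] t x1 sf(1,2) y w h_adj_w y_not_adj(1) sym by blast
  qed
  moreover have "E h x1" using x1X by (simp add: X_def)
  ultimately show False using split_second_heavy[of h t x1 R w "[y]"] split_single Xs by simp
qed

lemma path_Xs_w: "pth (Xs @ [w])" "length (Xs @ [w]) \<ge> 3" "set (Xs @ [w]) = V - {h} - {y}"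
proof -
  show "pth (Xs @ [w])"
    using sf(2,8,11) se(2) unfolding pth_append pth_Cons by (simp add: pth_def[of "[]"])
  show "length (Xs @ [w]) \<ge> 3" using x2 t(1) by (cases Xs rule: remdups_adj.cases) auto
  show "set (Xs @ [w]) = V - {h} - {y}" using V_eq y sf(5,6) by auto
qed

text \<open>The edge would close \<open>Xs\<close> and \<open>w\<close> to a cycle that misses only
  \<open>h\<close> and \<open>y\<close>.\<close>

lemma t_not_adj_w: "\<not> E t w"
proof
  assume "E t w"
  have "pth (Xs @ [w])" "length (Xs @ [w]) \<ge> 3" by (rule path_Xs_w)+
  moreover have "E (last (Xs @ [w])) (hd (Xs @ [w]))" using \<open>E t w\<close> sym sf(13) by simp
  ultimately have "cyc (Xs @ [w])" by (simp only: cyc_def)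
  moreover note path_Xs_w(3)
  ultimately show False using no_cyc_missing[OF sf(15), of "Xs @ [w]" "{y}"] y by auto
qed

text \<open>Reversed, the cycle starts with the triangle \<open>h, y, w\<close> and ends in
  \<open>t\<close>, which \<open>w\<close> does not see.\<close>

lemma w_light: "w \<notin> W"
proof
  assume "w \<in> W"
  have "cyc (rev (h # Xs @ [w, y]))" using split_single by (intro cyc_rev) (simp add: split_def)
  then have "cyc (h # y # w # rev Xs)" using cyc_rotate[of "y # w # rev Xs" "[h]"] by simp
  moreover have "set (h # y # w # rev Xs) = V" using V_eq by auto
  moreover have "\<not> E w (last (rev Xs))" using t_not_adj_w sym sf(13) by (auto simp: last_rev)
  moreover have "degree V E h + degree V E w \<ge> card V + 1"
    using heavy_degree[OF sf(15)] heavy_degree[OF \<open>w \<in> W\<close>] by linarith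
  ultimately show False using heavy_around_triangle[of h y w "rev Xs"] h_adj_w sf(13) np by simp
qed

text \<open>Deleting both \<open>h\<close> and \<open>y\<close> leaves a second cut vertex
  \<open>v\<close> on the same Hamiltonian cycle. The two cuts together bound the degree of
  \<open>h\<close> by 4, and only graphs with at most 7 vertices remain.\<close>

lemma contradiction: False
proof -
  note L = path_Xs_w(1,2) and setL = path_Xs_w(3)
  have "\<not> two_connected (V - {h} - {y}) E"
  proof (rule not_two_connected_Diff[OF sf(15)])
    fix g s assume "g \<in> W - {h} - {y}" "s \<in> {y}"
    then show "\<not> E g s" using w_light V_eq WV y_not_adj by blast
  qed (use y in auto)
  then obtain A v B' where AB: "Xs @ [w] = A @ v # B'" "A \<noteq> []" "B' \<noteq> []" "\<forall>x\<in>set A. \<forall>y\<in>set B'. \<not> E x y"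
    using not_two_connected_path[OF L] unfolding setL by metis
  obtain B where B: "B' = B @ [w]" "Xs = A @ v # B"
    using AB(1,3) by (cases B' rule: rev_cases) auto
  have tA: "t = hd A" using AB(2) B by simp
  have AX: "set A \<subseteq> set Xs" using B by auto
  have AB': "\<not> E a b" if "a \<in> set A" "b \<in> insert w (set B)" for a b using AB(4) B that by auto
  have sp: "split h A v (B @ [w, y])"
    using split_single AB' AX y_not_adj AB(2) unfolding split_def B(2) by auto
  \<comment> \<open>In the new split \<open>w\<close> is a second neighbour of \<open>h\<close> on
    the far arc, so the near arc must have none.\<close>
  have hA: "\<not> E h a" if "a \<in> set A" "a \<noteq> t" for a
    using wide_contradiction[OF sp, of a w] that h_adj_w y(8) tA by auto
  have tA': "t \<in> set A" using tA AB(2) by simp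
  \<comment> \<open>Otherwise the triangle \<open>w, y, h\<close> has the induced tail
    \<open>t, a\<close>, while \<open>t\<close> and \<open>w\<close> are light.\<close>
  have tna: "\<not> E t a" if "a \<in> set A" for a
  proof
    assume "E t a"
    then have "a \<noteq> t" "a \<in> V" using irr that AX sf(3) by auto
    moreover have "\<not> E w t" "\<not> E w a" "\<not> E y t" "\<not> E y a"
      using t_not_adj_w AB'[OF that] sym y_not_adj(2) t(1) that AX by blast+
    ultimately show False
      using z2[of w y h t a] sf(1,2) y t h_adj_w w_light hA[OF that] \<open>E t a\<close> sym by blast
  qed
  have "A = [t]"
  proof (cases A)
    case (Cons a A')
    have "pth A" using sf(11) B by (simp add: pth_append)
    then have "A' = []" using tna[of "hd A'"] Cons tA by (cases A') (auto simp: pth_Cons)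
    then show ?thesis using Cons tA by simp
  qed (use AB in simp)
  then have Xs: "Xs = t # v # B" using B by simp
  have onlyv: "x = v" if "x \<in> set Xs" "x \<noteq> t" "E h x" for x
  proof -
    have "E t x" using t_clique that by blast
    then have "x \<notin> set B" using AB' tA' by blast
    moreover have "x \<in> set (t # v # B)" using that(1) arg_cong[OF Xs, of set] by blast
    ultimately show ?thesis using that(2) by simp
  qed
  have v: "v \<in> set Xs" "v \<in> V" "E h v" "v \<noteq> t" "E t v" "v \<noteq> h" "v \<noteq> w" "v \<noteq> y"
  proof -
    show "v \<in> set Xs" using B by simp
    then show "v \<in> V" "v \<noteq> h" "v \<noteq> w" "v \<noteq> y" using sf(3,6,8) y(9) by auto
    have "x2 = v" using onlyv x2 by blast
    then show "E h v" "v \<noteq> t" using x2 by auto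
    then show "E t v" using t_clique \<open>v \<in> set Xs\<close> by blast
  qed
  have vW: "v \<notin> W" using split_second_heavy[of h t v B w "[y]"] split_single Xs v(3) by metis
  have "degree V E h \<le> card {t, v, w, y}"
  proof (rule degree_le)
    show "{t, v, w, y} \<subseteq> V" using t(5) v(2) sf(2) y(1) by simp
    fix z assume "z \<in> V" "E h z"
    then show "z \<in> {t, v, w, y}" using V_eq irr onlyv[of z] by blast
  qed
  also have "\<dots> \<le> 4" by (simp add: card_insert_if)
  finally have n7: "card V \<le> 7" using heavy_degree[OF sf(15)] by linarith
  have lB: "card V = length B + 5" using n_eq arg_cong[OF Xs, of length] by simp
  have c: "cyc (h # Xs @ [w, y])" "set (h # Xs @ [w, y]) = V" using split_single by (auto simp: split_def)
  have pX: "pth (t # v # B @ [w])" using L(1) arg_cong[OF Xs, of "\<lambda>zs. pth (zs @ [w])"] by simp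
  have hn: "h \<notin> set (t # v # B @ [w])"
  proof -
    have "set (t # v # B @ [w]) = insert w (set Xs)" using arg_cong[OF Xs, of set] by auto
    then show ?thesis using sf(5,6) by simp
  qed
  have wh: "E w h" using h_adj_w sym by blast
  have "cyc (h # t # v # B @ [w])" using pX hn t(2) sf(1) wh by (auto simp: cyc_def pth_Cons)
  then have l1: "has_len (card V - 1)" by (rule has_lenI) (simp add: lB)
  have "cyc (h # v # B @ [w])" using pX hn v(3) sf(1) wh by (auto simp: cyc_def pth_Cons)
  then have l2: "has_len (card V - 2)" by (rule has_lenI) (simp add: lB)
  have "cyc [h, w, y]" using sf(1,2,5) y h_adj_w by (auto simp: cyc_def pth_def)
  then have l3: "has_len 3" by (rule has_lenI) simp
  have l0: "has_len (card V)" using has_lenI[OF c(1)] spanning_length[OF c] by simp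
  \<comment> \<open>The one length not covered when n = 7. If \<open>v q\<close> is not an edge,
    \<open>p\<close> must be heavy, but it has only three possible neighbours instead of the four
    required.\<close>
  have l4: "has_len 4" if "length B = 2"
  proof -
    obtain p q where pq: "B = [p, q]" using \<open>length B = 2\<close> by (auto simp: length_Suc_conv numeral_2_eq_2)
    have pt: "pth (t # v # [p, q])" using sf(11) arg_cong[OF Xs, of pth] pq by simp
    then have e: "E v p" "E p q" "p \<in> V" "q \<in> V" "q \<noteq> v" "p \<noteq> t" "q \<noteq> t" "p \<noteq> v" by (auto simp: pth_Cons)
    have m: "p \<in> set Xs" "q \<in> set Xs" using arg_cong[OF Xs, of set] pq by auto
    have qw: "E q w" using se(2) arg_cong[OF Xs, of last] pq by simp
    have nh: "\<not> E h p" "\<not> E h q" "\<not> E t p" "\<not> E t q"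
      using onlyv[OF m(1) e(6)] onlyv[OF m(2) e(7)] e AB'[OF tA'] pq by auto
    show ?thesis
    proof (cases "E v q")
      case True
      then have "cyc [h, v, q, w]" using v sf(1-8) e m qw wh by (auto simp: cyc_def pth_def)
      then show ?thesis by (rule has_lenI) simp
    next
      case False
      then have "p \<in> W" using z2[of h t v p q] sf(1) t v e nh by blast
      moreover have "degree V E p \<le> card {v, q, w}"
      proof (rule degree_le)
        fix z assume z: "z \<in> V" "E p z"
        then have "z = h \<or> z = w \<or> z = y \<or> z \<in> set Xs" using V_eq by blast
        moreover have "set Xs = {t, v, p, q}" using arg_cong[OF Xs, of set] pq by simp
        moreover have "z \<noteq> h" "z \<noteq> t" "z \<noteq> p" "z \<noteq> y"
          using z(2) nh(1,3) y_not_adj(1)[OF m(1)] irr sym by blast+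
        ultimately show "z \<in> {v, q, w}" by blast
      qed (use v(2) e(4) sf(2) in simp)
      moreover have "card {v, q, w} \<le> 3" by (simp add: card_insert_if)
      ultimately show ?thesis using heavy_degree[of p] lB that by simp
    qed
  qed
  have "has_len k" if "3 \<le> k" "k \<le> card V" for k
  proof -
    have "k = 3 \<or> k = card V \<or> k = card V - 1 \<or> k = card V - 2 \<or> k = 4 \<and> length B = 2"
      using that n7 lB by linarith
    then show ?thesis using l0 l1 l2 l3 l4 by auto
  qed
  then show False using np pancyclicI by blast
qed

end

context heavy_graph
begin

text \<open>By \<open>split_z2\<close> at \<open>last Ys\<close> its predecessor on
  \<open>Ys\<close> would be a second neighbour of \<open>h\<close>, so \<open>Ys\<close> is a
  single vertex.\<close>

lemma one_sided_contradiction: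
  assumes s: "split h Xs w Ys" and x2: "x2 \<in> set Xs" "x2 \<noteq> hd Xs" "E h x2"
    and y: "\<And>y. y \<in> set Ys \<Longrightarrow> E h y \<Longrightarrow> y = last Ys"
  shows False
proof -
  interpret big_side V E W h w Xs Ys x2 by unfold_locales (fact s x2)+
  have "Ys = [last Ys]"
  proof (rule ccontr)
    assume n: "Ys \<noteq> [last Ys]"
    obtain Zs b where "Ys = Zs @ [b]" using sf(14) by (cases Ys rule: rev_cases) auto
    moreover from this obtain Zs' a where "Zs = Zs' @ [a]" using n by (cases Zs rule: rev_cases) auto
    ultimately have Ys: "Ys = Zs' @ [a, b]" by simp
    have ab: "E b a" "a \<noteq> b" using sf(12) sym unfolding Ys by (auto simp: pth_append pth_Cons)
    have "E h a"
      using split_z2[OF s t(1) x2(1) t(2) x2(3) _ t(4), of b a] t_clique[OF x2(1,3,2)] se(8)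
        split_last_light[OF s] ab(1) unfolding Ys by simp
    then show False using y[of a] ab unfolding Ys by simp
  qed
  then interpret narrow_split V E W h w Xs Ys x2 "last Ys" by unfold_locales
  show False by (rule contradiction)
qed

theorem no_heavy: "W = {}"
proof (rule ccontr)
  assume "W \<noteq> {}"
  then obtain h where h: "h \<in> W" by blast
  obtain C where C: "cyc C" "set C = V" using spanning_cyc by blast
  have "h \<in> set C" using C(2) h WV by blast
  then obtain L where "cyc (h # L)" "set (h # L) = set C" using cyc_at[OF C(1)] by blast
  then have L: "cyc (h # L)" "set (h # L) = V" using C(2) by simp_all
  obtain Xs w Ys where s: "split h Xs w Ys" and "L = Xs @ w # Ys" by (rule split_exists[OF h L])
  note f = split_facts[OF s] and e = split_edges[OF s]
  show False
  proof (cases "\<exists>x2\<in>set Xs. x2 \<noteq> hd Xs \<and> E h x2")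
    case True
    then show False using wide_contradiction[OF s] one_sided_contradiction[OF s] by metis
  next
    case X: False
    show False
    proof (cases "\<exists>y2\<in>set Ys. y2 \<noteq> last Ys \<and> E h y2")
      case True
      then obtain y2 where "y2 \<in> set Ys" "y2 \<noteq> last Ys" "E h y2" by blast
      then show False
        using one_sided_contradiction[OF split_rev[OF s], of y2] X f(13,14) by (auto simp: hd_rev last_rev)
    next
      case Y: False
      have N: "z \<in> {hd Xs, last Ys, w}" if "z \<in> V" "E h z" for z
        using that X Y irr f(17) by blast
      have V3: "{hd Xs, last Ys, w} \<subseteq> V" using e(9,12) f(2,3,4) by auto
      \<comment> \<open>Three possible neighbours leave n at most 5. As n is at least 4,
        \<open>h\<close> needs all three, in particular \<open>w\<close>, and one of the arcs is a
        single vertex.\<close>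
      have "degree V E h \<le> card {hd Xs, last Ys, w}" using N V3 by (intro degree_le) auto
      also have "\<dots> \<le> 3" by (simp add: card_insert_if)
      finally have n: "card V \<le> 5" "degree V E h \<le> 3" using heavy_degree[OF h] by linarith+
      have hw: "E h w"
      proof (rule ccontr)
        assume nhw: "\<not> E h w"
        have "degree V E h \<le> card {hd Xs, last Ys}"
        proof (rule degree_le)
          show "{hd Xs, last Ys} \<subseteq> V" using V3 by simp
          show "z \<in> {hd Xs, last Ys}" if "z \<in> V" "E h z" for z using N[OF that] that(2) nhw by blast
        qed
        also have "\<dots> \<le> 2" by (simp add: card_insert_if)
        finally show False using heavy_degree[OF h] card_V by linarith
      qed
      have l: "length Xs \<ge> 1" "length Ys \<ge> 1" using f(13,14) by (simp_all add: Suc_le_eq)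
      then consider "length Ys = 1" | "length Xs = 1" using n f(16) by linarith
      then show False
      proof cases
        case 1
        then obtain y where "Ys = [y]" by (auto simp: length_Suc_conv)
        then show False using split_tiny[of h Xs w y] s hw n by blast
      next
        case 2
        then obtain x where "Xs = [x]" by (auto simp: length_Suc_conv)
        then show False using split_tiny[of h "rev Ys" w x] split_rev[OF s] hw n by simp
      qed
    qed
  qed
qed

end

section \<open>From induced subgraphs to local conditions\<close>

lemma dist_eq_two:
  assumes "u \<in> X" "v \<in> X" "m \<in> X" "E u m" "E m v" "u \<noteq> v" "\<not> E u v"
  shows "dist_eq X E u v 2"
proof -
  have "walk_in X E [u, m, v]" using assms by (auto simp: walk_in_def less_Suc_eq)
  then have "has_walk X E u v 2" unfolding has_walk_def by (intro exI[of _ "[u, m, v]"]) auto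
  moreover have "\<not> has_walk X E u v k" if "k < 2" for k
  proof
    assume "has_walk X E u v k"
    then obtain xs where xs: "walk_in X E xs" "hd xs = u" "last xs = v" "length xs = Suc k"
      unfolding has_walk_def by blast
    consider "k = 0" | "k = 1" using \<open>k < 2\<close> by linarith
    then show False
    proof cases
      case 1
      then show ?thesis using xs assms(6) by (auto simp: length_Suc_conv)
    next
      case 2
      then obtain a b where "xs = [a, b]" using xs(4) by (auto simp: length_Suc_conv)
      then show ?thesis using xs assms(7) by (auto simp: walk_in_def)
    qed
  qed
  ultimately show ?thesis unfolding dist_eq_def by blast
qed

lemma f1_heavy_two:
  assumes "f1_heavy V E X" "u \<in> X" "v \<in> X" "m \<in> X" "X \<subseteq> V" "E u m" "E m v" "u \<noteq> v" "\<not> E u v"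
  shows "u \<in> {x \<in> V. 2 * degree V E x \<ge> card V + 1} \<or> v \<in> {x \<in> V. 2 * degree V E x \<ge> card V + 1}"
proof -
  have "2 * max (degree V E u) (degree V E v) \<ge> card V + 1"
    using assms dist_eq_two[of u X v m E] unfolding f1_heavy_def by blast
  then show ?thesis using assms(2,3,5) by (auto simp: max_def split: if_splits)
qed

lemma induced_copy_list:
  assumes "distinct xs" "set xs \<subseteq> V"
    and "\<And>i j. i < length xs \<Longrightarrow> j < length xs \<Longrightarrow> ER i j \<longleftrightarrow> E (xs ! i) (xs ! j)"
  shows "induced_copy V E {0..<length xs} ER (set xs)"
  unfolding induced_copy_def
proof (intro conjI exI)
  show "bij_betw ((!) xs) {0..<length xs} (set xs)"
    using assms(1) by (auto simp: bij_betw_def inj_on_def nth_eq_iff_index_eq in_set_conv_nth)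
qed (use assms in auto)

lemma R_f1_heavy_list:
  assumes R: "R_f1_heavy V E (fst S) (snd S)" and S: "fst S = {0..<length xs}"
    and xs: "distinct xs" "set xs \<subseteq> V"
    and E: "\<And>i j. i < length xs \<Longrightarrow> j < length xs \<Longrightarrow> snd S i j \<longleftrightarrow> E (xs ! i) (xs ! j)"
  shows "f1_heavy V E (set xs)"
proof -
  have "induced_copy V E {0..<length xs} (snd S) (set xs)"
    by (rule induced_copy_list[OF xs]) (rule E)
  then show ?thesis using R unfolding S R_f1_heavy_def by blast
qed

theorem theorem10:
  fixes V :: "'a set" and E :: "'a \<Rightarrow> 'a \<Rightarrow> bool"
    and S :: "nat set \<times> (nat \<Rightarrow> nat \<Rightarrow> bool)"
  assumes "simple_graph V E"
    and "connected_graph (fst S) (snd S)"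
    and "S \<noteq> path_graph 3"
    and "two_connected V E"
    and "R_f1_heavy V E (fst claw) (snd claw)"
    and "\<not> is_cycle_graph V E"
    and "S \<in> {path_graph 4, Z_graph 1, Z_graph 2}"
    and "R_f1_heavy V E (fst S) (snd S)"
  shows "pancyclic V E"
proof (rule ccontr)
  assume np: "\<not> pancyclic V E"
  define W where "W = {x \<in> V. 2 * degree V E x \<ge> card V + 1}"
  have sym: "E y x" if "E x y" for x y using assms(1) that unfolding simple_graph_def by blast
  have irr: "\<not> E x x" for x using assms(1) unfolding simple_graph_def by blast
  have ne: "x \<noteq> y" if "E x y" for x y using that irr by blast
  have two: "u \<in> W \<or> v \<in> W" if "f1_heavy V E X" "u \<in> X" "v \<in> X" "m \<in> X" "X \<subseteq> V" "E u m" "E m v" "u \<noteq> v" "\<not> E u v"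
    for X u v m
    unfolding W_def using that by (rule f1_heavy_two)
  \<comment> \<open>Replaces bounded indices by literals, so that the adjacency tables below can be
    evaluated entry by entry.\<close>
  have all4: "(\<forall>i j. i < (4::nat) \<longrightarrow> j < (4::nat) \<longrightarrow> P i j) \<longleftrightarrow> (\<forall>i\<in>{0,1,2,3}. \<forall>j\<in>{0,1,2,3}. P i j)" for P
  proof -
    have "{0,1,2,3} = {i. i < (4::nat)}" by auto
    then show ?thesis by auto
  qed
  have all5: "(\<forall>i j. i < (5::nat) \<longrightarrow> j < (5::nat) \<longrightarrow> P i j) \<longleftrightarrow> (\<forall>i\<in>{0,1,2,3,4}. \<forall>j\<in>{0,1,2,3,4}. P i j)" for P
  proof -
    have "{0,1,2,3,4} = {i. i < (5::nat)}" by auto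
    then show ?thesis by auto
  qed
  interpret wgraph V E W
  proof
    show "finite V" using assms(1) unfolding simple_graph_def by blast
    show "E x y \<Longrightarrow> E y x" for x y by (rule sym)
    show "\<not> E x x" for x by (rule irr)
    show "W \<subseteq> V" by (auto simp: W_def)
    fix c a b d assume V: "c \<in> V" "a \<in> V" "b \<in> V" "d \<in> V" and e: "E c a" "E c b" "E c d"
      and n: "a \<noteq> b" "a \<noteq> d" "b \<noteq> d" "\<not> E a b" "\<not> E a d" "\<not> E b d"
    have "f1_heavy V E (set [c, a, b, d])"
    proof (rule R_f1_heavy_list[OF assms(5)])
      show "fst claw = {0..<length [c, a, b, d]}" by (auto simp: claw_def)
      have "\<forall>i\<in>{0,1,2,3}. \<forall>j\<in>{0,1,2,3}. snd claw i j \<longleftrightarrow> E ([c, a, b, d] ! i) ([c, a, b, d] ! j)"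
        using e n irr sym by (auto simp: claw_def)
      then show "snd claw i j \<longleftrightarrow> E ([c, a, b, d] ! i) ([c, a, b, d] ! j)"
        if "i < length [c, a, b, d]" "j < length [c, a, b, d]" for i j
        using that all4[of "\<lambda>i j. snd claw i j \<longleftrightarrow> E ([c, a, b, d] ! i) ([c, a, b, d] ! j)"] by simp
    qed (use V n e ne in auto)
    then have H: "f1_heavy V E {c, a, b, d}" by simp
    have "a \<in> W \<or> b \<in> W" "a \<in> W \<or> d \<in> W" "b \<in> W \<or> d \<in> W"
      using two[OF H, of a b c] two[OF H, of a d c] two[OF H, of b d c] V e n sym[OF e(1)] sym[OF e(2)] by auto
    then show "a \<in> W \<and> b \<in> W \<or> a \<in> W \<and> d \<in> W \<or> b \<in> W \<and> d \<in> W" by blast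
  next
    fix a b c d e
    assume V: "a \<in> V" "b \<in> V" "c \<in> V" "d \<in> V" "e \<in> V"
      and ed: "E a b" "E a c" "E b c" "E c d" "E d e"
      and n: "\<not> E a d" "\<not> E b d" "\<not> E a e" "\<not> E b e" "\<not> E c e"
    have sy: "E b a" "E c a" "E c b" "E d c" "E e d" "\<not> E d a" "\<not> E d b" "\<not> E e a" "\<not> E e b" "\<not> E e c"
      using ed n sym by blast+
    have neq: "a \<noteq> b" "a \<noteq> c" "b \<noteq> c" "c \<noteq> d" "d \<noteq> e" "a \<noteq> d" "b \<noteq> d" "a \<noteq> e" "b \<noteq> e" "c \<noteq> e"
      using ed n sy irr by blast+
    \<comment> \<open>A P_4 can use only one triangle vertex besides \<open>c\<close>, so
      \<open>a\<close> and \<open>b\<close> need a path each.\<close>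
    have path: "f1_heavy V E {u, c, d, e}" if S: "S = path_graph 4" and u: "u = a \<or> u = b" for u
    proof -
      have u': "u \<in> V" "E u c" "\<not> E u d" "\<not> E u e" "E c u" "\<not> E d u" "\<not> E e u" "u \<noteq> c" "u \<noteq> d" "u \<noteq> e"
        using u V ed n sy neq by auto
      have "f1_heavy V E (set [u, c, d, e])"
      proof (rule R_f1_heavy_list[OF assms(8)])
        show "fst S = {0..<length [u, c, d, e]}" by (auto simp: S path_graph_def)
        have "\<forall>i\<in>{0,1,2,3}. \<forall>j\<in>{0,1,2,3}. snd S i j \<longleftrightarrow> E ([u, c, d, e] ! i) ([u, c, d, e] ! j)"
          using u' ed n sy irr by (simp add: S path_graph_def)
        then show "snd S i j \<longleftrightarrow> E ([u, c, d, e] ! i) ([u, c, d, e] ! j)"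
          if "i < length [u, c, d, e]" "j < length [u, c, d, e]" for i j
          using that all4[of "\<lambda>i j. snd S i j \<longleftrightarrow> E ([u, c, d, e] ! i) ([u, c, d, e] ! j)"] by simp
      qed (use V u' neq in auto)
      then show ?thesis by simp
    qed
    have Z1: "f1_heavy V E {a, b, c, d}" if S: "S = Z_graph 1"
    proof -
      have "f1_heavy V E (set [a, b, c, d])"
      proof (rule R_f1_heavy_list[OF assms(8)])
        show "fst S = {0..<length [a, b, c, d]}" by (auto simp: S Z_graph_def)
        have "\<forall>i\<in>{0,1,2,3}. \<forall>j\<in>{0,1,2,3}. snd S i j \<longleftrightarrow> E ([a, b, c, d] ! i) ([a, b, c, d] ! j)"
          using ed n sy irr by (simp add: S Z_graph_def)
        then show "snd S i j \<longleftrightarrow> E ([a, b, c, d] ! i) ([a, b, c, d] ! j)"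
          if "i < length [a, b, c, d]" "j < length [a, b, c, d]" for i j
          using that all4[of "\<lambda>i j. snd S i j \<longleftrightarrow> E ([a, b, c, d] ! i) ([a, b, c, d] ! j)"] by simp
      qed (use V neq in auto)
      then show ?thesis by simp
    qed
    have Z2: "f1_heavy V E {a, b, c, d, e}" if S: "S = Z_graph 2"
    proof -
      have "f1_heavy V E (set [a, b, c, d, e])"
      proof (rule R_f1_heavy_list[OF assms(8)])
        show "fst S = {0..<length [a, b, c, d, e]}" by (auto simp: S Z_graph_def)
        have "\<forall>i\<in>{0,1,2,3,4}. \<forall>j\<in>{0,1,2,3,4}. snd S i j \<longleftrightarrow> E ([a, b, c, d, e] ! i) ([a, b, c, d, e] ! j)"
          using ed n sy irr by (simp add: S Z_graph_def)
        then show "snd S i j \<longleftrightarrow> E ([a, b, c, d, e] ! i) ([a, b, c, d, e] ! j)"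
          if "i < length [a, b, c, d, e]" "j < length [a, b, c, d, e]" for i j
          using that all5[of "\<lambda>i j. snd S i j \<longleftrightarrow> E ([a, b, c, d, e] ! i) ([a, b, c, d, e] ! j)"] by simp
      qed (use V neq in auto)
      then show ?thesis by simp
    qed
    \<comment> \<open>Each of the three subgraphs contains \<open>u\<close>, \<open>c\<close> and
      \<open>d\<close>, with \<open>u\<close> and \<open>d\<close> at distance two; this is all that
      is used of \<open>S\<close>.\<close>
    have "\<exists>X. f1_heavy V E X \<and> {u, c, d} \<subseteq> X \<and> X \<subseteq> V" if "u = a \<or> u = b" for u
      using assms(7) path[OF _ that] Z1 Z2 V that by fastforce
    then have "u \<in> W \<or> d \<in> W" if "u = a \<or> u = b" for u
      using two[of _ u d c] that ed n neq by (metis insert_subset)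
    then show "d \<in> W \<or> a \<in> W \<and> b \<in> W" by blast
  qed
  have EV: "x \<in> V \<and> y \<in> V" if "E x y" for x y using assms(1) that unfolding simple_graph_def by blast
  interpret heavy_graph V E W
    by unfold_locales (use assms(4) np W_def in auto)
  show False using pancyclic_if_W_empty[OF no_heavy assms(4) EV assms(6)] np by blast
qed

end
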